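(* Let $\lambda_1\neq\lambda_2$ be positive, $\tau\in(0,1)$, and let $\Delta_n\to0$, $n\Delta_n\to\infty$ as $n\to\infty$. Then the estimator $\hat\tau=\hat k_0/n$ of $\tau$ satisfies $$\hat\tau-\tau=O_p\!\left(\frac1{n\Delta_n(\gamma_2-\gamma_1)^2}\right).$$
   Context: Fix $v>0$. For each $n\ge 2$ let $\Delta_n>0$, $T=n\Delta_n$, $t_i=i\Delta_n$ for $i=0,\dots,n$. The telegraph process is $X(t)=V(0)\int_0^t(-1)^{N(s)}\,ds$, $0\le t\le T$, where $N$ is an inhomogeneous Poisson process with intensity $\lambda(t)=\lambda_1\mathbf 1_{\{t\le\theta_0\}}+\lambda_2\mathbf 1_{\{t>\theta_0\}}$, and $V(0)$ is independent of $N$ and takes the values $+v,-v$ with probability $1/2$ each. The change occurs at the observation time $\theta_0=k_0\Delta_n$ with $k_0=[n\tau]$ (integer part). Only $X_i=X(t_i)$, $i=0,\dots,n$ (with $X_0=0$) are observed. Put $\eta_i=X_i-X_{i-1}$ and $Y_i=\mathbf 1_{\{|\eta_i|<v\Delta_n\}}/\Delta_n$, $i=1,\dots,n$. Let $\gamma_m=\frac{1-e^{-\lambda_m\Delta_n}}{\Delta_n}$, $m=1,2$, which is the mean of $Y_i$ for $i\le k_0$ ($m=1$) and for $i>k_0$ ($m=2$). For $1\le k\le n-1$ let $\bar Y_k=\frac1k\sum_{i=1}^kY_i$, $\bar Y_{n-k}=\frac1{n-k}\sum_{i=k+1}^nY_i$ (the mean of the last $n-k$ variables), and $$V_k=\sqrt{\frac{k(n-k)}{n^2}}\,(\bar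 Y_{n-k}-\bar Y_k).$$ The least squares change point estimator $\hat k_0$ is $$\hat k_0=\arg\min_{1\le k\le n-1}\Big\{\sum_{i=1}^k(Y_i-\bar Y_k)^2+\sum_{i=k+1}^n(Y_i-\bar Y_{n-k})^2\Big\}=\arg\max_{1\le k\le n-1}V_k^2 .$$ *)

theory Defs
  imports "HOL-Probability.Probability"
begin

text \<open>
  Processes are indexed as \<open>N t \<omega>\<close> (time first). The mean of the increment over
  \<open>(s, t]\<close> is the integral of the intensity. The Poisson weights are written out because
  the library's \<open>poisson_pmf\<close> is specified for positive rates only. Paths are counting
  paths for every \<open>\<omega>\<close>: nat carries the discrete topology, so right continuity means
  being locally constant to the right.
\<close>

definition (in prob_space) inhom_poisson_process ::
    "real \<Rightarrow> (real \<Rightarrow> real) \<Rightarrow> (real \<Rightarrow> 'a \<Rightarrow> nat) \<Rightarrow> bool" where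
  "inhom_poisson_process T lam N \<longleftrightarrow>
     (\<forall>t\<in>{0..T}. random_variable (count_space UNIV) (N t)) \<and>
     (\<forall>\<omega>\<in>space M. N 0 \<omega> = 0 \<and> mono_on {0..T} (\<lambda>t. N t \<omega>) \<and>
        (\<forall>t\<in>{0..<T}. continuous (at_right t) (\<lambda>s. N s \<omega>))) \<and>
     (\<forall>(m::nat) (t :: nat \<Rightarrow> real). 0 \<le> t 0 \<and> (\<forall>j<m. t j < t (Suc j)) \<and> t m \<le> T \<longrightarrow>
        indep_vars (\<lambda>_. count_space UNIV) (\<lambda>j \<omega>. N (t (Suc j)) \<omega> - N (t j) \<omega>) {..<m}) \<and>
     (\<forall>s t. 0 \<le> s \<and> s < t \<and> t \<le> T \<longrightarrow>
        (\<forall>j::nat. prob {\<omega>\<in>space M. N t \<omega> - N s \<omega> = j} =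
           integral {s..t} lam ^ j / fact j * exp (- integral {s..t} lam)))"

text \<open>
  The initial velocity \<open>V\<close> is independent of the whole process \<open>N\<close>, taken as a random
  element of the product space over the time interval. This is stated with the generated
  sigma-algebras because the library's \<open>indep_var\<close> wants both variables to have the same type.
\<close>

definition (in prob_space) telegraph_data ::
    "real \<Rightarrow> real \<Rightarrow> (real \<Rightarrow> real) \<Rightarrow> ('a \<Rightarrow> real) \<Rightarrow> (real \<Rightarrow> 'a \<Rightarrow> nat) \<Rightarrow> bool" where
  "telegraph_data v T lam V N \<longleftrightarrow>
     inhom_poisson_process T lam N \<and>
     random_variable borel V \<and>
     prob {\<omega>\<in>space M. V \<omega> = v} = 1/2 \<and> prob {\<omega>\<in>space M. V \<omega> = - v} = 1/2 \<and>
     indep_set (sets (vimage_algebra (space M) V borel))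
       (sets (vimage_algebra (space M) (\<lambda>\<omega>. \<lambda>t\<in>{0..T}. N t \<omega>)
          (PiM {0..T} (\<lambda>_. count_space UNIV))))"

definition telegraph :: "('a \<Rightarrow> real) \<Rightarrow> (real \<Rightarrow> 'a \<Rightarrow> nat) \<Rightarrow> real \<Rightarrow> 'a \<Rightarrow> real" where
  "telegraph V N t \<omega> = V \<omega> * integral {0..t} (\<lambda>s. (- 1) ^ N s \<omega>)"

definition change_intensity :: "real \<Rightarrow> real \<Rightarrow> real \<Rightarrow> real \<Rightarrow> real" where
  "change_intensity l1 l2 \<theta> t = (if t \<le> \<theta> then l1 else l2)"

definition change_index :: "nat \<Rightarrow> real \<Rightarrow> nat" where
  "change_index n \<tau> = nat \<lfloor>real n * \<tau>\<rfloor>"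

text \<open>The variables \<open>Y\<close> obtained from the observations \<open>x i = X(i d)\<close> with mesh \<open>d\<close>.\<close>

definition switch_var :: "real \<Rightarrow> real \<Rightarrow> (nat \<Rightarrow> real) \<Rightarrow> nat \<Rightarrow> real" where
  "switch_var v d x i = (if \<bar>x i - x (i - 1)\<bar> < v * d then 1 else 0) / d"

definition gamma_mean :: "real \<Rightarrow> real \<Rightarrow> real" where
  "gamma_mean l d = (1 - exp (- l * d)) / d"

definition head_mean :: "(nat \<Rightarrow> real) \<Rightarrow> nat \<Rightarrow> real" where
  "head_mean y k = (\<Sum>i=1..k. y i) / real k"

definition tail_mean :: "nat \<Rightarrow> (nat \<Rightarrow> real) \<Rightarrow> nat \<Rightarrow> real" where
  "tail_mean n y k = (\<Sum>i=k+1..n. y i) / real (n - k)"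

definition split_sse :: "nat \<Rightarrow> (nat \<Rightarrow> real) \<Rightarrow> nat \<Rightarrow> real" where
  "split_sse n y k =
     (\<Sum>i=1..k. (y i - head_mean y k)\<^sup>2) + (\<Sum>i=k+1..n. (y i - tail_mean n y k)\<^sup>2)"

definition split_contrast :: "nat \<Rightarrow> (nat \<Rightarrow> real) \<Rightarrow> nat \<Rightarrow> real" where
  "split_contrast n y k =
     sqrt (real k * real (n - k) / (real n)\<^sup>2) * (tail_mean n y k - head_mean y k)"

text \<open>
  The minimiser need not be unique, so the least squares estimator is described by a
  predicate that admits every way of breaking ties.
\<close>

definition is_lse_change_point :: "nat \<Rightarrow> (nat \<Rightarrow> real) \<Rightarrow> nat \<Rightarrow> bool" where
  "is_lse_change_point n y k \<longleftrightarrow> is_arg_min (split_sse n y) (\<lambda>k. 1 \<le> k \<and> k \<le> n - 1) k"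

lemma sum_sq_dev:
  fixes y :: "nat \<Rightarrow> real"
  assumes "finite A" "A \<noteq> {}"
  shows "(\<Sum>i\<in>A. (y i - sum y A / card A)\<^sup>2) = (\<Sum>i\<in>A. (y i)\<^sup>2) - (sum y A)\<^sup>2 / card A"
proof -
  have c: "real (card A) > 0" using assms by (simp add: card_gt_0_iff)
  let ?m = "sum y A / card A"
  have "(\<Sum>i\<in>A. (y i - ?m)\<^sup>2) = (\<Sum>i\<in>A. (y i)\<^sup>2 - 2 * ?m * y i + ?m\<^sup>2)"
    by (intro sum.cong refl) (simp add: power2_diff)
  also have "\<dots> = (\<Sum>i\<in>A. (y i)\<^sup>2) - 2 * ?m * sum y A + card A * ?m\<^sup>2"
    by (simp add: sum.distrib sum_subtractf sum_distrib_left)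
  also have "\<dots> = (\<Sum>i\<in>A. (y i)\<^sup>2) - (sum y A)\<^sup>2 / card A"
    using c by (simp add: field_simps power2_eq_square)
  finally show ?thesis .
qed

lemma split_sse_contrast:
  fixes y :: "nat \<Rightarrow> real"
  assumes "1 \<le> k" "k \<le> n - 1"
  shows "split_sse n y k + real n * (split_contrast n y k)\<^sup>2 =
     (\<Sum>i=1..n. (y i)\<^sup>2) - (\<Sum>i=1..n. y i)\<^sup>2 / real n"
proof -
  have k: "0 < k" "k < n" using assms by auto
  define a b where "a = (\<Sum>i=1..k. y i)" and "b = (\<Sum>i=k+1..n. y i)"
  have un: "{1..n} = {1..k} \<union> {k+1..n}" "{1..k} \<inter> {k+1..n} = {}" using k by auto
  have s1: "(\<Sum>i=1..n. y i) = a + b"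
    unfolding a_def b_def un(1) by (rule sum.union_disjoint) auto
  have s2: "(\<Sum>i=1..n. (y i)\<^sup>2) = (\<Sum>i=1..k. (y i)\<^sup>2) + (\<Sum>i=k+1..n. (y i)\<^sup>2)"
    unfolding un(1) by (rule sum.union_disjoint) auto
  have h: "(\<Sum>i=1..k. (y i - head_mean y k)\<^sup>2) = (\<Sum>i=1..k. (y i)\<^sup>2) - a\<^sup>2 / real k"
    using sum_sq_dev[of "{1..k}" y] k by (simp add: head_mean_def a_def)
  have t: "(\<Sum>i=k+1..n. (y i - tail_mean n y k)\<^sup>2) = (\<Sum>i=k+1..n. (y i)\<^sup>2) - b\<^sup>2 / real (n - k)"
    using sum_sq_dev[of "{k+1..n}" y] k by (simp add: tail_mean_def b_def)
  define p q where "p = real k" and "q = real (n - k)"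
  have pq: "p > 0" "q > 0" "real n = p + q" using k by (auto simp: p_def q_def)
  have "(split_contrast n y k)\<^sup>2 = p * q / (p + q)\<^sup>2 * (b / q - a / p)\<^sup>2"
    using pq unfolding split_contrast_def head_mean_def tail_mean_def a_def b_def
    by (simp add: power_mult_distrib p_def q_def)
  moreover have "(p + q) * (p * q / (p + q)\<^sup>2 * (b / q - a / p)\<^sup>2) =
      a\<^sup>2 / p + b\<^sup>2 / q - (a + b)\<^sup>2 / (p + q)"
  proof -
    have "b / q - a / p = (b * p - a * q) / (p * q)" using pq by (simp add: field_simps)
    hence "(p + q) * (p * q / (p + q)\<^sup>2 * (b / q - a / p)\<^sup>2) = (b * p - a * q)\<^sup>2 / (p * q * (p + q))"
      using pq by (simp add: power_divide power2_eq_square)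
    also have "\<dots> = ((a\<^sup>2 * q + b\<^sup>2 * p) * (p + q) - (a + b)\<^sup>2 * (p * q)) / (p * q * (p + q))"
      by (simp add: power2_eq_square algebra_simps)
    also have "\<dots> = a\<^sup>2 / p + b\<^sup>2 / q - (a + b)\<^sup>2 / (p + q)"
      using pq by (simp add: diff_divide_distrib add_divide_distrib)
    finally show ?thesis .
  qed
  ultimately show ?thesis
    unfolding split_sse_def h t s1 s2 pq(3) p_def[symmetric] q_def[symmetric] by simp
qed

lemma is_lse_change_point_iff_arg_max:
  "is_lse_change_point n y k \<longleftrightarrow>
     is_arg_max (\<lambda>k. (split_contrast n y k)\<^sup>2) (\<lambda>k. 1 \<le> k \<and> k \<le> n - 1) k"
proof -
  have "split_sse n y j < split_sse n y k \<longleftrightarrow>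
      (split_contrast n y k)\<^sup>2 < (split_contrast n y j)\<^sup>2"
    if "1 \<le> k" "k \<le> n - 1" "1 \<le> j" "j \<le> n - 1" for j
  proof -
    have n: "real n > 0" using that by auto
    have "split_sse n y j < split_sse n y k \<longleftrightarrow>
        real n * (split_contrast n y k)\<^sup>2 < real n * (split_contrast n y j)\<^sup>2"
      using split_sse_contrast[OF that(1,2), of y] split_sse_contrast[OF that(3,4), of y]
      by linarith
    thus ?thesis using n by simp
  qed
  thus ?thesis
    unfolding is_lse_change_point_def is_arg_min_def is_arg_max_def by blast
qed

text \<open>
  \<open>Z n = O_p(a n)\<close>, where the \<open>n\<close>-th variable lives on its own probability space \<open>M n\<close>.
\<close>

definition bigO_prob :: "(nat \<Rightarrow> 'a measure) \<Rightarrow> (nat \<Rightarrow> 'a \<Rightarrow> real) \<Rightarrow> (nat \<Rightarrow> real) \<Rightarrow> bool" where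
  "bigO_prob M Z a \<longleftrightarrow>
     (\<forall>\<epsilon>>0. \<exists>C>0. eventually (\<lambda>n. measure (M n) {\<omega>\<in>space (M n). \<bar>Z n \<omega>\<bar> > C * \<bar>a n\<bar>} < \<epsilon>)
        sequentially)"

end

theory Submission
  imports Defs
begin

text \<open>
  The variables \<open>Y\<close> of the theorem are almost surely \<open>1 / \<Delta>\<close> times the indicators of an event of the Poisson
  process in the successive cells (\<open>increment_detects_events\<close>). Hence they are independent, with mean
  \<open>\<gamma>\<^sub>1\<close> up to the change and \<open>\<gamma>\<^sub>2\<close> after it, and with variance of order \<open>1 / \<Delta>\<close>. Since \<open>\<gamma>\<^sub>m\<close> tends to
  \<open>\<lambda>\<^sub>m\<close>, the claimed rate means that, with high probability, the estimator misses \<open>k\<^sub>0\<close> by at most a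
  constant times \<open>1 / \<Delta>\<close> cells.
  
  An average over \<open>j\<close> cells has variance of order \<open>1 / (j \<Delta>)\<close>, so that \<open>K / \<Delta>\<close> cells are just enough to tell
  \<open>\<gamma>\<^sub>1\<close> from \<open>\<gamma>\<^sub>2\<close>. By the Hajek--Renyi inequality this holds uniformly: for large \<open>K\<close>, with high
  probability all averages over at least \<open>K / \<Delta>\<close> cells starting from the left end, from the right end or from
  \<open>k\<^sub>0\<close> are close to their means (\<open>linear_boundary_crossing\<close>). On this event a split at \<open>k\<close> more than
  \<open>K / \<Delta>\<close> cells beyond \<open>k\<^sub>0\<close> cannot be optimal. Its two fitted levels \<open>a\<close> and \<open>b\<close> are close to a proper mixture of
  \<open>\<gamma>\<^sub>1\<close> and \<open>\<gamma>\<^sub>2\<close>, and to \<open>\<gamma>\<^sub>2\<close>; the observations between \<open>k\<^sub>0\<close> and \<open>k\<close> average to about \<open>\<gamma>\<^sub>2\<close> and so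
  are fitted better by \<open>b\<close>, and moving the split back to \<open>k\<^sub>0\<close> lowers the residual sum.
  
  This reasoning fails when \<open>k\<close> is within \<open>K / \<Delta>\<close> cells of the right end, where \<open>b\<close> averages few observations.
  There the tail is so short that, with high probability, its contribution to the reduction of the residual
  sum is only of order \<open>1 / \<Delta>\<close>, while the split at \<open>k\<^sub>0\<close> gains an amount of order \<open>n\<close>; the latter wins because
  \<open>n \<Delta>\<close> tends to infinity (\<open>no_overshoot\<close>, \<open>overshoot_prob\<close>). Splits far to the left of \<open>k\<^sub>0\<close> are treated by time
  reversal (\<open>lse_deviation_prob\<close>).
\<close>

section \<open>A maximal inequality\<close>

text \<open>
  Lets one maximal inequality for sequences serve for sums that start at the left end, at the right
  end, or at the change point.
\<close>
lemma (in prob_space) indep_vars_reindex_inj: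
  assumes indep: "indep_vars (\<lambda>_. N) X (f ` I)" and inj: "inj_on f I"
  shows "indep_vars (\<lambda>_. N) (\<lambda>i. X (f i)) I"
proof -
  have "indep_sets (\<lambda>i. {X (f i) -` A \<inter> space M |A. A \<in> sets N}) I"
  proof (rule indep_setsI)
    show "{X (f i) -` A \<inter> space M |A. A \<in> sets N} \<subseteq> events" if "i \<in> I" for i
      using indep that by (auto simp: indep_vars_def2 intro: measurable_sets)
  next
    fix A J
    assume J: "J \<noteq> {}" "J \<subseteq> I" "finite J"
      and A: "\<forall>j\<in>J. A j \<in> {X (f j) -` B \<inter> space M |B. B \<in> sets N}"
    have inj': "inj_on f J" using inj J(2) by (rule inj_on_subset)
    have inv: "the_inv_into J f (f j) = j" if "j \<in> J" for j
      using inj' that by (rule the_inv_into_f_f)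
    define B where "B = (\<lambda>i. A (the_inv_into J f i))"
    have "prob (\<Inter>i\<in>f ` J. B i) = (\<Prod>i\<in>f ` J. prob (B i))"
    proof (rule indep_setsD)
      show "indep_sets (\<lambda>i. {X i -` A \<inter> space M |A. A \<in> sets N}) (f ` I)"
        using indep by (auto simp: indep_vars_def2)
      show "\<forall>i\<in>f ` J. B i \<in> {X i -` A \<inter> space M |A. A \<in> sets N}"
        using A by (auto simp: B_def inv)
    qed (use J in auto)
    moreover have "(\<Inter>i\<in>f ` J. B i) = (\<Inter>j\<in>J. A j)"
      by (simp add: B_def inv)
    moreover have "(\<Prod>i\<in>f ` J. prob (B i)) = (\<Prod>j\<in>J. prob (A j))"
      by (subst prod.reindex[OF inj']) (simp add: B_def inv)
    ultimately show "prob (\<Inter>j\<in>J. A j) = (\<Prod>j\<in>J. prob (A j))" by simp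
  qed
  thus ?thesis using indep by (auto simp: indep_vars_def2)
qed

text \<open>
  The Hajek--Renyi inequality. A direct recursion replaces stopping times: let \<open>Q j\<close> be \<open>1\<close> once
  the weighted walk has left the unit interval, and \<open>(c j S j)\<^sup>2\<close> before. As \<open>c\<close> decreases, one step
  raises the expectation of \<open>Q\<close> by at most \<open>(c (j + 1))\<^sup>2\<close> times the variance of the new summand,
  because the cross term vanishes by independence; and \<open>Q n\<close> dominates the indicator of the exit.
\<close>
theorem (in prob_space) hajek_renyi:
  fixes X :: "nat \<Rightarrow> 'a \<Rightarrow> real" and c :: "nat \<Rightarrow> real"
  assumes indep: "indep_vars (\<lambda>_. borel) X {..<n}"
    and sq: "\<And>i. i < n \<Longrightarrow> integrable M (\<lambda>\<omega>. (X i \<omega>)\<^sup>2)"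
    and mean: "\<And>i. i < n \<Longrightarrow> expectation (X i) = 0"
    and c: "\<And>i. 0 \<le> c i" "\<And>i. c (Suc i) \<le> c i"
  shows "prob {\<omega>\<in>space M. \<exists>j\<le>n. 1 \<le> c j * \<bar>\<Sum>i<j. X i \<omega>\<bar>}
    \<le> (\<Sum>j<n. (c (Suc j))\<^sup>2 * expectation (\<lambda>\<omega>. (X j \<omega>)\<^sup>2))"
proof -
  have X: "X i \<in> borel_measurable M" if "i < n" for i
    using indep that by (auto simp: indep_vars_def2)
  have int: "integrable M (X i)" if "i < n" for i
    by (rule square_integrable_imp_integrable[OF X sq]) (use that in auto)
  define S where "S = (\<lambda>j \<omega>. \<Sum>i<j. X i \<omega>)"
  define safe where "safe = (\<lambda>j \<omega>. \<forall>l\<le>j. c l * \<bar>S l \<omega>\<bar> < 1)"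
  define Q where "Q = (\<lambda>j \<omega>. if safe j \<omega> then (c j)\<^sup>2 * (S j \<omega>)\<^sup>2 else 1)"
  have S: "S j \<in> borel_measurable M" if "j \<le> n" for j
    unfolding S_def using that by (intro borel_measurable_sum X) auto
  have safe: "Measurable.pred M (safe j)" if "j \<le> n" for j
  proof -
    have "Measurable.pred M (\<lambda>\<omega>. \<forall>l\<in>{..j}. c l * \<bar>S l \<omega>\<bar> < 1)"
      by (intro pred_intros_finite borel_measurable_pred_less borel_measurable_times
          borel_measurable_abs borel_measurable_const S) (use that in auto)
    thus ?thesis by (simp only: safe_def Ball_def atMost_iff)
  qed
  have S_sq: "integrable M (\<lambda>\<omega>. (S j \<omega>)\<^sup>2)" if "j \<le> n" for j
    using that
  proof (induction j)
    case 0
    thus ?case by (simp add: S_def)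
  next
    case (Suc j)
    have "integrable M (\<lambda>\<omega>. 2 * (S j \<omega>)\<^sup>2 + 2 * (X j \<omega>)\<^sup>2)"
      using Suc sq[of j] by auto
    moreover have "(\<lambda>\<omega>. (S (Suc j) \<omega>)\<^sup>2) \<in> borel_measurable M"
      using S[OF Suc.prems] by measurable
    moreover have "AE \<omega> in M. norm ((S (Suc j) \<omega>)\<^sup>2) \<le> norm (2 * (S j \<omega>)\<^sup>2 + 2 * (X j \<omega>)\<^sup>2)"
    proof (rule AE_I2)
      fix \<omega>
      have "(S j \<omega> + X j \<omega>)\<^sup>2 \<le> 2 * (S j \<omega>)\<^sup>2 + 2 * (X j \<omega>)\<^sup>2"
        using zero_le_power2[of "S j \<omega> - X j \<omega>"] by (simp add: power2_eq_square algebra_simps)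
      thus "norm ((S (Suc j) \<omega>)\<^sup>2) \<le> norm (2 * (S j \<omega>)\<^sup>2 + 2 * (X j \<omega>)\<^sup>2)"
        by (simp add: S_def)
    qed
    ultimately show ?case by (rule Bochner_Integration.integrable_bound)
  qed
  have S_int: "integrable M (S j)" if "j \<le> n" for j
    by (rule square_integrable_imp_integrable[OF S S_sq]) (use that in auto)
  have cut_int: "integrable M (\<lambda>\<omega>. of_bool (safe j \<omega>) * f \<omega>)"
    if "j \<le> n" "integrable M f" for j and f :: "'a \<Rightarrow> real"
  proof (rule Bochner_Integration.integrable_bound[OF that(2)])
    have [measurable]: "Measurable.pred M (safe j)" "f \<in> borel_measurable M"
      using safe[OF that(1)] borel_measurable_integrable[OF that(2)] by auto
    show "(\<lambda>\<omega>. of_bool (safe j \<omega>) * f \<omega>) \<in> borel_measurable M"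
      by measurable
  qed auto
  have Q_alt: "Q j \<omega> = of_bool (safe j \<omega>) * ((c j)\<^sup>2 * (S j \<omega>)\<^sup>2) + (1 - of_bool (safe j \<omega>) * 1)"
    for j \<omega>
    by (simp add: Q_def)
  have Q_int: "integrable M (Q j)" if "j \<le> n" for j
    unfolding Q_alt[abs_def]
    by (intro Bochner_Integration.integrable_add Bochner_Integration.integrable_diff
        cut_int that integrable_mult_right S_sq) auto
  (* Survival up to j and S j depend on X 0, ..., X (j - 1) only, hence are independent of X j. *)
  have cross: "expectation (\<lambda>\<omega>. of_bool (safe j \<omega>) * S j \<omega> * X j \<omega>) = 0" if j: "j < n" for j
  proof -
    define F :: "(nat \<Rightarrow> real) \<Rightarrow> real"
      where "F = (\<lambda>x. of_bool (\<forall>l\<le>j. c l * \<bar>\<Sum>i<l. x i\<bar> < 1) * (\<Sum>i<j. x i))"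
    have F: "F \<in> borel_measurable (PiM {..<j} (\<lambda>_. borel))"
    proof -
      have x: "(\<lambda>x. \<Sum>i<l. x i) \<in> borel_measurable (PiM {..<j} (\<lambda>_. borel :: real measure))"
        if "l \<le> j" for l
        by (intro borel_measurable_sum measurable_component_singleton) (use that in auto)
      have "Measurable.pred (PiM {..<j} (\<lambda>_. borel))
          (\<lambda>x. \<forall>l\<in>{..j}. c l * \<bar>\<Sum>i<l. x i\<bar> < 1)"
        by (intro pred_intros_finite borel_measurable_pred_less borel_measurable_times
            borel_measurable_abs borel_measurable_const x) auto
      hence [measurable]: "Measurable.pred (PiM {..<j} (\<lambda>_. borel))
          (\<lambda>x. \<forall>l\<le>j. c l * \<bar>\<Sum>i<l. x i\<bar> < 1)"
        by (simp only: Ball_def atMost_iff)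
      show ?thesis unfolding F_def using x[OF order_refl] by measurable
    qed
    have "indep_var (PiM {..<j} (\<lambda>_. borel)) (\<lambda>\<omega>. restrict (\<lambda>i. X i \<omega>) {..<j})
        (PiM {j} (\<lambda>_. borel)) (\<lambda>\<omega>. restrict (\<lambda>i. X i \<omega>) {j})"
      by (rule indep_var_restrict[OF indep]) (use j in auto)
    hence "indep_var borel (F \<circ> (\<lambda>\<omega>. restrict (\<lambda>i. X i \<omega>) {..<j}))
        borel ((\<lambda>x. x j) \<circ> (\<lambda>\<omega>. restrict (\<lambda>i. X i \<omega>) {j}))"
      by (rule indep_var_compose[OF _ F]) auto
    moreover have "F \<circ> (\<lambda>\<omega>. restrict (\<lambda>i. X i \<omega>) {..<j}) = (\<lambda>\<omega>. of_bool (safe j \<omega>) * S j \<omega>)"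
    proof -
      have "(\<Sum>i<l. restrict (\<lambda>i. X i \<omega>) {..<j} i) = S l \<omega>" if "l \<le> j" for l \<omega>
        unfolding S_def using that by (intro sum.cong) auto
      thus ?thesis by (auto simp: F_def safe_def fun_eq_iff)
    qed
    moreover have "(\<lambda>x. x j) \<circ> (\<lambda>\<omega>. restrict (\<lambda>i. X i \<omega>) {j}) = X j"
      by (simp add: fun_eq_iff)
    ultimately have ind: "indep_var borel (\<lambda>\<omega>. of_bool (safe j \<omega>) * S j \<omega>) borel (X j)"
      by simp
    show ?thesis
      using indep_var_lebesgue_integral[OF ind cut_int[OF _ S_int] int[OF j]] j mean[OF j]
      by simp
  qed
  have step: "expectation (Q (Suc j)) \<le>
      expectation (Q j) + (c (Suc j))\<^sup>2 * expectation (\<lambda>\<omega>. (X j \<omega>)\<^sup>2)"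
    if j: "j < n" for j
  proof -
    have cross_int: "integrable M (\<lambda>\<omega>. of_bool (safe j \<omega>) * (S j \<omega> * X j \<omega>))"
    proof (rule cut_int)
      have "integrable M (\<lambda>\<omega>. ((S (Suc j) \<omega>)\<^sup>2 - (S j \<omega>)\<^sup>2 - (X j \<omega>)\<^sup>2) / 2)"
        using S_sq[of j] S_sq[of "Suc j"] sq[of j] j by auto
      thus "integrable M (\<lambda>\<omega>. S j \<omega> * X j \<omega>)"
        by (rule back_subst[of "integrable M"])
          (auto simp: S_def power2_eq_square fun_eq_iff algebra_simps)
    qed (use j in auto)
    have "Q (Suc j) \<omega> \<le> Q j \<omega> + 2 * (c (Suc j))\<^sup>2 * (of_bool (safe j \<omega>) * (S j \<omega> * X j \<omega>))
        + (c (Suc j))\<^sup>2 * (X j \<omega>)\<^sup>2" for \<omega>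
    proof (cases "safe j \<omega>")
      case False
      hence "\<not> safe (Suc j) \<omega>" unfolding safe_def using le_SucI by blast
      thus ?thesis using False by (simp add: Q_def)
    next
      case True
      have "Q (Suc j) \<omega> \<le> (c (Suc j) * \<bar>S (Suc j) \<omega>\<bar>)\<^sup>2"
      proof (cases "safe (Suc j) \<omega>")
        case False
        hence "1 \<le> c (Suc j) * \<bar>S (Suc j) \<omega>\<bar>"
          using True by (auto simp: safe_def le_Suc_eq)
        thus ?thesis using False by (simp add: Q_def)
      qed (simp add: Q_def power_mult_distrib)
      also have "\<dots> = (c (Suc j))\<^sup>2 * (S j \<omega>)\<^sup>2 + 2 * (c (Suc j))\<^sup>2 * (S j \<omega> * X j \<omega>)
          + (c (Suc j))\<^sup>2 * (X j \<omega>)\<^sup>2"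
        by (simp add: S_def power_mult_distrib power2_sum algebra_simps)
      also have "(c (Suc j))\<^sup>2 * (S j \<omega>)\<^sup>2 \<le> (c j)\<^sup>2 * (S j \<omega>)\<^sup>2"
        using c by (intro mult_right_mono power_mono) auto
      finally show ?thesis using True by (simp add: Q_def)
    qed
    hence "expectation (Q (Suc j)) \<le>
        expectation (\<lambda>\<omega>. Q j \<omega> + 2 * (c (Suc j))\<^sup>2 * (of_bool (safe j \<omega>) * (S j \<omega> * X j \<omega>))
        + (c (Suc j))\<^sup>2 * (X j \<omega>)\<^sup>2)"
      using j Q_int[of "Suc j"] Q_int[of j] cross_int sq[of j]
      by (intro integral_mono) auto
    also have "\<dots> = expectation (Q j)
        + 2 * (c (Suc j))\<^sup>2 * expectation (\<lambda>\<omega>. of_bool (safe j \<omega>) * (S j \<omega> * X j \<omega>))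
        + (c (Suc j))\<^sup>2 * expectation (\<lambda>\<omega>. (X j \<omega>)\<^sup>2)"
      using j Q_int[of j] cross_int sq[of j] by simp
    finally show ?thesis using cross[OF j] by (simp add: mult.assoc)
  qed
  have bound: "expectation (Q j) \<le> (\<Sum>l<j. (c (Suc l))\<^sup>2 * expectation (\<lambda>\<omega>. (X l \<omega>)\<^sup>2))"
    if "j \<le> n" for j
    using that
  proof (induction j)
    case 0
    show ?case by (simp add: Q_def safe_def S_def)
  next
    case (Suc j)
    thus ?case using step[of j] by simp
  qed
  have "{\<omega>\<in>space M. \<exists>j\<le>n. 1 \<le> c j * \<bar>S j \<omega>\<bar>} = {\<omega>\<in>space M. \<not> safe n \<omega>}"
    by (auto simp: safe_def not_less)
  hence "prob {\<omega>\<in>space M. \<exists>j\<le>n. 1 \<le> c j * \<bar>S j \<omega>\<bar>} =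
      expectation (indicator {\<omega>\<in>space M. \<not> safe n \<omega>})"
    using safe[of n] by simp
  also have "\<dots> \<le> expectation (Q n)"
    using safe[of n] Q_int[of n]
    by (intro integral_mono) (auto simp: Q_def less_top[symmetric])
  also note bound[of n]
  finally show ?thesis by (simp add: S_def)
qed

text \<open>
  The bound is \<open>m / m\<^sup>2\<close> for the indices up to \<open>m\<close>, plus the telescoping bound \<open>1 / m\<close> for the rest.
\<close>
lemma sum_inverse_square_max:
  assumes "m \<ge> 1"
  shows "(\<Sum>j<n. 1 / (real (max (Suc j) m))\<^sup>2) \<le> 2 / real m"
proof -
  have "(\<Sum>j<n. 1 / (real (max (Suc j) m))\<^sup>2) \<le>
      (if n \<le> m then real n / (real m)\<^sup>2 else 2 / real m - 1 / real n)"
  proof (induction n)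
    case (Suc n)
    show ?case
    proof (cases "n < m")
      case True
      hence "max (Suc n) m = m" by simp
      thus ?thesis using Suc True by (simp add: add_divide_distrib)
    next
      case False
      hence n: "n \<ge> m" "n \<ge> 1" using assms by auto
      have "real n / (real m)\<^sup>2 = 2 / real m - 1 / real n" if "n = m"
        using that assms by (simp add: power2_eq_square field_simps)
      hence "(\<Sum>j<n. 1 / (real (max (Suc j) m))\<^sup>2) \<le> 2 / real m - 1 / real n"
        using Suc False n by (auto split: if_splits)
      moreover have "1 / (real (Suc n))\<^sup>2 \<le> 1 / real n - 1 / real (Suc n)"
      proof -
        have "1 / (real (Suc n))\<^sup>2 \<le> 1 / (real n * real (Suc n))"
          using n by (intro divide_left_mono) (auto simp: power2_eq_square)
        also have "\<dots> = 1 / real n - 1 / real (Suc n)"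
          using n by (simp add: field_simps)
        finally show ?thesis .
      qed
      moreover have "max (Suc n) m = Suc n" using n by simp
      ultimately show ?thesis using n by simp
    qed
  qed simp
  also have "\<dots> \<le> 2 / real m"
    using assms by (auto simp: field_simps power2_eq_square)
  finally show ?thesis .
qed

text \<open>
  Hajek--Renyi with the weights \<open>1 / (r max j m)\<close>, which freeze below \<open>m\<close>. The bound depends on neither
  the number of summands nor any logarithm of it; this is what yields the exact rate.
\<close>
corollary (in prob_space) linear_boundary_crossing:
  fixes X :: "nat \<Rightarrow> 'a \<Rightarrow> real"
  assumes indep: "indep_vars (\<lambda>_. borel) X {..<n}"
    and sq: "\<And>i. i < n \<Longrightarrow> integrable M (\<lambda>\<omega>. (X i \<omega>)\<^sup>2)"
    and mean: "\<And>i. i < n \<Longrightarrow> expectation (X i) = 0"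
    and var: "\<And>i. i < n \<Longrightarrow> expectation (\<lambda>\<omega>. (X i \<omega>)\<^sup>2) \<le> s"
    and s: "0 \<le> s" and r: "0 < r" and m: "1 \<le> m"
  shows "prob {\<omega>\<in>space M. \<exists>j. m \<le> j \<and> j \<le> n \<and> r * real j \<le> \<bar>\<Sum>i<j. X i \<omega>\<bar>} \<le> 2 * s / (r\<^sup>2 * real m)"
proof -
  have X: "X i \<in> borel_measurable M" if "i < n" for i
    using indep that by (auto simp: indep_vars_def2)
  have S: "(\<lambda>\<omega>. \<Sum>i<j. X i \<omega>) \<in> borel_measurable M" if "j \<le> n" for j
    using that by (intro borel_measurable_sum X) auto
  define c where "c = (\<lambda>j. 1 / (r * real (max j m)))"
  have "prob {\<omega>\<in>space M. \<exists>j. m \<le> j \<and> j \<le> n \<and> r * real j \<le> \<bar>\<Sum>i<j. X i \<omega>\<bar>}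
      \<le> prob {\<omega>\<in>space M. \<exists>j\<le>n. 1 \<le> c j * \<bar>\<Sum>i<j. X i \<omega>\<bar>}"
  proof (rule finite_measure_mono)
    show "{\<omega>\<in>space M. \<exists>j. m \<le> j \<and> j \<le> n \<and> r * real j \<le> \<bar>\<Sum>i<j. X i \<omega>\<bar>}
        \<subseteq> {\<omega>\<in>space M. \<exists>j\<le>n. 1 \<le> c j * \<bar>\<Sum>i<j. X i \<omega>\<bar>}"
      using r m by (auto simp: c_def max_def field_simps intro!: exI)
    have "{\<omega>\<in>space M. \<exists>j\<in>{..n}. 1 \<le> c j * \<bar>\<Sum>i<j. X i \<omega>\<bar>} \<in> events"
      by (intro sets.sets_Collect_finite_Ex borel_measurable_le borel_measurable_times
          borel_measurable_abs borel_measurable_const S) auto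
    thus "{\<omega>\<in>space M. \<exists>j\<le>n. 1 \<le> c j * \<bar>\<Sum>i<j. X i \<omega>\<bar>} \<in> events"
      by (simp only: Bex_def atMost_iff)
  qed
  also have "\<dots> \<le> (\<Sum>j<n. (c (Suc j))\<^sup>2 * expectation (\<lambda>\<omega>. (X j \<omega>)\<^sup>2))"
  proof (rule hajek_renyi[OF indep sq mean])
    show "0 \<le> c i" "c (Suc i) \<le> c i" for i
      using r m by (auto simp: c_def intro!: frac_le)
  qed auto
  also have "\<dots> \<le> (\<Sum>j<n. (c (Suc j))\<^sup>2 * s)"
    by (intro sum_mono mult_left_mono var) auto
  also have "\<dots> = s / r\<^sup>2 * (\<Sum>j<n. 1 / (real (max (Suc j) m))\<^sup>2)"
    by (simp add: c_def sum_distrib_left power_divide power_mult_distrib mult.commute)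
  also have "\<dots> \<le> s / r\<^sup>2 * (2 / real m)"
    by (intro mult_left_mono sum_inverse_square_max m) (use s in auto)
  finally show ?thesis by (simp add: mult.commute)
qed

section \<open>Least squares splits of a sequence\<close>

definition step_mean :: "nat \<Rightarrow> real \<Rightarrow> real \<Rightarrow> nat \<Rightarrow> real" where
  "step_mean k0 g1 g2 i = (if i \<le> k0 then g1 else g2)"

lemma sum_split_at:
  fixes f :: "nat \<Rightarrow> real"
  assumes "a \<le> k" "k \<le> b"
  shows "(\<Sum>i=a+1..b. f i) = (\<Sum>i=a+1..k. f i) + (\<Sum>i=k+1..b. f i)"
proof -
  have "{a+1..b} = {a+1..k} \<union> {k+1..b}" using assms by auto
  thus ?thesis by (simp only:) (rule sum.union_disjoint, auto)
qed

lemma sum_sq_dev_le: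
  fixes y :: "nat \<Rightarrow> real"
  assumes "finite A" "A \<noteq> {}"
  shows "(\<Sum>i\<in>A. (y i - sum y A / card A)\<^sup>2) \<le> (\<Sum>i\<in>A. (y i - a)\<^sup>2)"
proof -
  have c: "real (card A) > 0" using assms by (simp add: card_gt_0_iff)
  have "(\<Sum>i\<in>A. (y i - a)\<^sup>2) = (\<Sum>i\<in>A. (y i)\<^sup>2) - 2 * a * sum y A + card A * a\<^sup>2"
  proof -
    have "(\<Sum>i\<in>A. (y i - a)\<^sup>2) = (\<Sum>i\<in>A. (y i)\<^sup>2 - 2 * a * y i + a\<^sup>2)"
      by (intro sum.cong refl) (simp add: power2_diff)
    thus ?thesis by (simp add: sum.distrib sum_subtractf sum_distrib_left)
  qed
  also have "\<dots> = (\<Sum>i\<in>A. (y i - sum y A / card A)\<^sup>2) + (card A * a - sum y A)\<^sup>2 / card A"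
    unfolding sum_sq_dev[OF assms] using c by (simp add: field_simps power2_eq_square)
  finally show ?thesis using c by simp
qed

lemma split_sse_le_fixed_levels:
  assumes "1 \<le> k" "k < n"
  shows "split_sse n y k \<le> (\<Sum>i=1..k. (y i - a)\<^sup>2) + (\<Sum>i=k+1..n. (y i - b)\<^sup>2)"
  using sum_sq_dev_le[of "{1..k}" y a] sum_sq_dev_le[of "{k+1..n}" y b] assms
  unfolding split_sse_def head_mean_def tail_mean_def by auto

text \<open>
  The levels \<open>a\<close>, \<open>b\<close> fitted at \<open>k\<close> are also admissible, though in general not optimal, for the split at \<open>k0\<close>. The two
  residual sums then differ only on \<open>(k0, k]\<close>, so a good fit at \<open>k\<close> says that the observations between
  \<open>k0\<close> and \<open>k\<close> are on average nearer to \<open>a\<close> than to \<open>b\<close>.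
\<close>
lemma overshoot_increment:
  assumes k: "1 \<le> k0" "k0 < k" "k < n" and le: "split_sse n y k \<le> split_sse n y k0"
  defines "a \<equiv> head_mean y k" and "b \<equiv> tail_mean n y k"
  shows "(b - a) * (2 * (\<Sum>i=k0+1..k. y i) - real (k - k0) * (a + b)) \<le> 0"
proof -
  define A B where "A = (\<lambda>i. (y i - a)\<^sup>2)" and "B = (\<lambda>i. (y i - b)\<^sup>2)"
  have "split_sse n y k = sum A {1..k} + sum B {k+1..n}"
    by (simp add: split_sse_def A_def B_def a_def b_def)
  moreover have "sum A {1..k} = sum A {1..k0} + sum A {k0+1..k}"
    using sum_split_at[of 0 k0 k A] k by simp
  moreover have "split_sse n y k0 \<le> sum A {1..k0} + sum B {k0+1..n}"
    unfolding A_def B_def by (rule split_sse_le_fixed_levels) (use k in auto)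
  moreover have "sum B {k0+1..n} = sum B {k0+1..k} + sum B {k+1..n}"
    using sum_split_at[of k0 k n B] k by simp
  ultimately have "sum A {k0+1..k} - sum B {k0+1..k} \<le> 0" using le by linarith
  moreover have "sum A {k0+1..k} - sum B {k0+1..k} = (\<Sum>i=k0+1..k. (b - a) * (2 * y i - (a + b)))"
    unfolding sum_subtractf[symmetric] A_def B_def
    by (intro sum.cong) (auto simp: power2_eq_square algebra_simps)
  moreover have "\<dots> = (b - a) * (2 * (\<Sum>i=k0+1..k. y i) - real (k - k0) * (a + b))"
    by (simp add: sum_distrib_left[symmetric] sum_subtractf)
  ultimately show ?thesis by simp
qed

text \<open>
  Time reversal turns a split to the left of \<open>k0\<close> into one to the right, so that only the latter needs
  an argument.
\<close>
lemma split_sse_reverse: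
  assumes "k \<le> n"
  shows "split_sse n (\<lambda>i. y (n + 1 - i)) (n - k) = split_sse n y k"
proof -
  have head: "(\<Sum>i=1..n-k. f (n + 1 - i)) = (\<Sum>i=k+1..n. f i)" for f :: "nat \<Rightarrow> real"
    by (rule sum.reindex_bij_witness[of _ "\<lambda>i. n + 1 - i" "\<lambda>i. n + 1 - i"]) (use assms in auto)
  have tail: "(\<Sum>i=n-k+1..n. f (n + 1 - i)) = (\<Sum>i=1..k. f i)" for f :: "nat \<Rightarrow> real"
    by (rule sum.reindex_bij_witness[of _ "\<lambda>i. n + 1 - i" "\<lambda>i. n + 1 - i"]) (use assms in auto)
  have "head_mean (\<lambda>i. y (n + 1 - i)) (n - k) = tail_mean n y k"
    using head[of y] by (simp add: head_mean_def tail_mean_def)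
  moreover have "tail_mean n (\<lambda>i. y (n + 1 - i)) (n - k) = head_mean y k"
    using tail[of y] assms by (simp add: head_mean_def tail_mean_def)
  ultimately show ?thesis
    using head[of "\<lambda>i. (y i - tail_mean n y k)\<^sup>2"] tail[of "\<lambda>i. (y i - head_mean y k)\<^sup>2"]
    unfolding split_sse_def by simp
qed

lemma sum_step_mean_head:
  assumes "k0 \<le> k"
  shows "(\<Sum>i=1..k. step_mean k0 g1 g2 i) = real k * g2 - real k0 * (g2 - g1)"
proof -
  have "(\<Sum>i=1..k. step_mean k0 g1 g2 i) =
      (\<Sum>i=1..k0. step_mean k0 g1 g2 i) + (\<Sum>i=k0+1..k. step_mean k0 g1 g2 i)"
    using sum_split_at[of 0 k0 k "step_mean k0 g1 g2"] assms by simp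
  also have "\<dots> = real k0 * g1 + real (k - k0) * g2"
    by (simp add: step_mean_def)
  finally show ?thesis using assms by (simp add: of_nat_diff algebra_simps)
qed

lemma head_mean_near:
  assumes "\<bar>\<Sum>i=1..k. (y i - step_mean k0 g1 g2 i)\<bar> < r * real k" "k0 \<le> k" "0 < k"
  shows "\<bar>head_mean y k - (g2 - real k0 / real k * (g2 - g1))\<bar> < r"
proof -
  have "real k * (head_mean y k - (g2 - real k0 / real k * (g2 - g1))) =
      (\<Sum>i=1..k. (y i - step_mean k0 g1 g2 i))"
    unfolding sum_subtractf sum_step_mean_head[OF assms(2)] head_mean_def
    using assms(3) by (simp add: field_simps)
  hence "real k * \<bar>head_mean y k - (g2 - real k0 / real k * (g2 - g1))\<bar> < r * real k"
    using assms(1) by (metis abs_mult abs_of_nat)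
  thus ?thesis using assms(3) by simp
qed

lemma late_sum_near:
  assumes "\<bar>\<Sum>i=k+1..l. (y i - step_mean k0 g1 g2 i)\<bar> < r * real (l - k)" "k0 \<le> k" "k < l"
  shows "\<bar>(\<Sum>i=k+1..l. y i) / real (l - k) - g2\<bar> < r"
proof -
  define q where "q = real (l - k)"
  have q: "0 < q" using assms(3) by (simp add: q_def)
  have "(\<Sum>i=k+1..l. step_mean k0 g1 g2 i) = (\<Sum>i=k+1..l. g2)"
    using assms(2) by (intro sum.cong) (auto simp: step_mean_def)
  also have "\<dots> = q * g2" by (simp add: q_def)
  finally have "q * ((\<Sum>i=k+1..l. y i) / q - g2) = (\<Sum>i=k+1..l. (y i - step_mean k0 g1 g2 i))"
    using q by (simp add: sum_subtractf field_simps)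
  hence "q * \<bar>(\<Sum>i=k+1..l. y i) / q - g2\<bar> < r * q"
    using assms(1) q by (metis abs_mult abs_of_pos q_def)
  thus ?thesis using q by (simp add: q_def)
qed

lemma product_pos_near:
  fixes d :: real
  assumes "\<bar>p - d\<bar> < \<bar>d\<bar>" "\<bar>q - d\<bar> < \<bar>d\<bar>"
  shows "0 < p * q"
  using assms by (cases "d > 0") (auto intro: mult_pos_pos mult_neg_neg)

text \<open>
  The deterministic core. All averages over at least \<open>m\<close> observations, taken from the left end, from the right
  end, or directly after \<open>k0\<close>, are within \<open>r\<close> of their means. If \<open>k\<close> is at least \<open>m\<close> away from \<open>n\<close>, the
  fitted levels are near \<open>g2 - s (g2 - g1)\<close> with \<open>s = k0 / k\<close>, and near \<open>g2\<close>, while the average over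
  \<open>(k0, k]\<close> is near \<open>g2\<close>: this contradicts \<open>overshoot_increment\<close>. If \<open>k\<close> is within \<open>m\<close> of \<open>n\<close>, the right
  level is not controlled by averaging. There the assumption \<open>edge\<close> bounds \<open>n\<close> times the squared contrast by
  \<open>L + m (G + r)\<^sup>2\<close>, whereas at \<open>k0\<close> it is at least \<open>c\<^sup>2 r\<^sup>2 n\<close>.
\<close>
theorem no_overshoot:
  fixes y :: "nat \<Rightarrow> real"
  assumes r: "0 < r" and c: "0 < c" "5 * r \<le> c * \<bar>g2 - g1\<bar>"
    and k0: "c * real n \<le> real k0" "c * real n \<le> real (n - k0)"
    and m: "1 \<le> m" "m \<le> k0" "m \<le> n - k0"
    and k: "k0 + m \<le> k" "k < n"
    and y: "\<And>i. i \<in> {1..n} \<Longrightarrow> 0 \<le> y i"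
    and G: "0 \<le> g1" "g1 \<le> G" "0 \<le> g2" "g2 \<le> G"
    and head: "\<And>j. m \<le> j \<Longrightarrow> j \<le> n \<Longrightarrow> \<bar>\<Sum>i=1..j. (y i - step_mean k0 g1 g2 i)\<bar> < r * real j"
    and tail: "\<And>j. m \<le> j \<Longrightarrow> j \<le> n \<Longrightarrow> \<bar>\<Sum>i=n-j+1..n. (y i - step_mean k0 g1 g2 i)\<bar> < r * real j"
    and right: "\<And>j. m \<le> j \<Longrightarrow> j \<le> n - k0 \<Longrightarrow>
       \<bar>\<Sum>i=k0+1..k0+j. (y i - step_mean k0 g1 g2 i)\<bar> < r * real j"
    and edge: "\<And>j. 1 \<le> j \<Longrightarrow> j < m \<Longrightarrow> (\<Sum>i=n-j+1..n. y i)\<^sup>2 \<le> L * real j"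
    and L: "L + real m * (G + r)\<^sup>2 < c\<^sup>2 * r\<^sup>2 * real n"
  shows "split_sse n y k0 < split_sse n y k"
proof (rule ccontr)
  assume "\<not> ?thesis"
  hence le: "split_sse n y k \<le> split_sse n y k0" by simp
  define a b d where "a = head_mean y k" and "b = tail_mean n y k" and "d = g2 - g1"
  have k0': "1 \<le> k0" "k0 < k" using m k by auto
  have n: "0 < n" using k by simp
  have c1: "c \<le> 1"
  proof -
    have "c * real n \<le> 1 * real n" using k0(1) k k0'(2) by linarith
    thus ?thesis by (rule mult_right_le_imp_le) (use n in simp)
  qed
  have "\<bar>d\<bar> * c \<le> \<bar>d\<bar> * 1" using c1 by (intro mult_left_mono) auto
  hence d5: "5 * r \<le> \<bar>d\<bar>" using c(2) by (simp add: d_def mult.commute)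
  have a: "\<bar>a - (g2 - real k0 / real k * d)\<bar> < r"
    unfolding a_def d_def by (rule head_mean_near) (use head[of k] m k in auto)
  show False
  proof (cases "m \<le> n - k")
    case True
    have b: "\<bar>b - g2\<bar> < r"
      unfolding b_def tail_mean_def by (rule late_sum_near[where ?k0.0 = k0 and ?g1.0 = g1]) (use tail[of "n - k"] True m k in auto)
    define z where "z = (\<Sum>i=k0+1..k. y i) / real (k - k0)"
    have z: "\<bar>z - g2\<bar> < r"
      unfolding z_def by (rule late_sum_near[where ?k0.0 = k0 and ?g1.0 = g1]) (use right[of "k - k0"] m k in auto)
    define s where "s = real k0 / real k"
    have "c \<le> s"
    proof -
      have "c * real k \<le> c * real n" using c k by (intro mult_left_mono) auto
      thus ?thesis using k0 k0' by (simp add: s_def field_simps)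
    qed
    hence "c * \<bar>d\<bar> \<le> s * \<bar>d\<bar>" by (intro mult_right_mono) auto
    also have "\<dots> = \<bar>s * d\<bar>" by (simp add: abs_mult s_def)
    finally have sd: "5 * r \<le> \<bar>s * d\<bar>" using c(2) by (simp add: d_def)
    (* Both factors are within 4 r of s d, whose modulus is at least 5 r. *)
    have "0 < (b - a) * (2 * z - (a + b))"
      by (rule product_pos_near[of _ "s * d"]) (use sd a b z r in \<open>auto simp: s_def[symmetric]\<close>)
    moreover have "0 < real (k - k0)" using k0' by simp
    ultimately have "0 < (b - a) * (2 * z - (a + b)) * real (k - k0)" by (rule mult_pos_pos)
    also have "\<dots> = (b - a) * (2 * (\<Sum>i=k0+1..k. y i) - real (k - k0) * (a + b))"
      using k0' by (simp add: z_def field_simps)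
    finally show False
      using overshoot_increment[OF k0' k(2) le] by (simp add: a_def b_def)
  next
    case False
    define j where "j = n - k"
    have j: "1 \<le> j" "j < m" "n - j = k" using False k by (auto simp: j_def)
    have range: "1 \<le> k0" "k0 \<le> n - 1" "1 \<le> k" "k \<le> n - 1" using k k0' by auto
    have contrast: "real n * (split_contrast n y k0)\<^sup>2 \<le> real n * (split_contrast n y k)\<^sup>2"
      using split_sse_contrast[OF range(1,2), of y] split_sse_contrast[OF range(3,4), of y] le
      by linarith
    have sq: "real n * (split_contrast n y i)\<^sup>2 =
        real i * real (n - i) / real n * (tail_mean n y i - head_mean y i)\<^sup>2" for i
      using n by (simp add: split_contrast_def power_mult_distrib) (simp add: power2_eq_square)
    have k0n: "c * real n * (c * real n) \<le> real k0 * real (n - k0)"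
      using k0 c by (intro mult_mono) auto
    have "c\<^sup>2 * r\<^sup>2 * real n = c * real n * (c * real n) / real n * r\<^sup>2"
      using n by (simp add: power2_eq_square)
    also have "\<dots> \<le> real k0 * real (n - k0) / real n * (tail_mean n y k0 - head_mean y k0)\<^sup>2"
    proof (rule mult_mono[OF divide_right_mono[OF k0n]])
      have "\<bar>head_mean y k0 - (g2 - real k0 / real k0 * d)\<bar> < r"
        unfolding d_def by (rule head_mean_near) (use head[of k0] m k in auto)
      moreover have "\<bar>tail_mean n y k0 - g2\<bar> < r"
        unfolding tail_mean_def
        by (rule late_sum_near[where ?k0.0 = k0 and ?g1.0 = g1]) (use tail[of "n - k0"] m k in auto)
      ultimately have "\<bar>r\<bar> \<le> \<bar>tail_mean n y k0 - head_mean y k0\<bar>"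
        using d5 r k0' by simp
      thus "r\<^sup>2 \<le> (tail_mean n y k0 - head_mean y k0)\<^sup>2" by (simp only: abs_le_square_iff)
    qed auto
    also have "\<dots> \<le> real k * real j / real n * (b - a)\<^sup>2"
      using contrast unfolding sq a_def b_def j_def .
    also have "\<dots> \<le> real j * (b - a)\<^sup>2"
    proof (rule mult_right_mono)
      have "real k * real j \<le> real n * real j" using k by (intro mult_right_mono) auto
      thus "real k * real j / real n \<le> real j" using n by (simp add: field_simps)
    qed auto
    also have "\<dots> \<le> real j * (b\<^sup>2 + a\<^sup>2)"
    proof (rule mult_left_mono)
      have "0 \<le> a" "0 \<le> b"
        using k y unfolding a_def b_def head_mean_def tail_mean_def
        by (auto intro!: divide_nonneg_nonneg sum_nonneg)
      hence "0 \<le> a * b" by simp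
      thus "(b - a)\<^sup>2 \<le> b\<^sup>2 + a\<^sup>2" by (simp add: power2_diff mult.commute)
    qed auto
    also have "\<dots> \<le> L + real m * (G + r)\<^sup>2"
    proof -
      have "real j * b\<^sup>2 = (\<Sum>i=n-j+1..n. y i)\<^sup>2 / real j"
        using j k by (simp add: b_def tail_mean_def j_def power_divide) (simp add: power2_eq_square)
      also have "\<dots> \<le> L" using edge[OF j(1,2)] j by (simp add: field_simps)
      finally have "real j * b\<^sup>2 \<le> L" .
      moreover have "real j * a\<^sup>2 \<le> real m * (G + r)\<^sup>2"
      proof (intro mult_mono power_mono)
        have s: "0 \<le> real k0 / real k" "real k0 / real k \<le> 1" using k0' by auto
        have "g2 - real k0 / real k * d = (1 - real k0 / real k) * g2 + real k0 / real k * g1"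
          by (simp add: d_def algebra_simps diff_divide_distrib)
        also have "\<dots> \<le> (1 - real k0 / real k) * G + real k0 / real k * G"
          using G s by (intro add_mono mult_left_mono) auto
        also have "\<dots> = G" by (simp add: algebra_simps)
        finally show "a \<le> G + r" using a by linarith
        show "0 \<le> a" using k y unfolding a_def head_mean_def
          by (auto intro!: divide_nonneg_nonneg sum_nonneg)
      qed (use j in auto)
      ultimately show ?thesis by (simp add: algebra_simps)
    qed
    finally show False using L by simp
  qed
qed

lemma split_sse_cong:
  assumes "\<And>i. i \<in> {1..n} \<Longrightarrow> y i = z i" "k \<le> n"
  shows "split_sse n y k = split_sse n z k"
proof -
  have "head_mean y k = head_mean z k"
    unfolding head_mean_def using assms by (intro arg_cong2[of _ _ _ _ "(/)"] sum.cong) auto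
  moreover have "tail_mean n y k = tail_mean n z k"
    unfolding tail_mean_def using assms by (intro arg_cong2[of _ _ _ _ "(/)"] sum.cong) auto
  ultimately show ?thesis
    unfolding split_sse_def using assms by (intro arg_cong2[of _ _ _ _ "(+)"] sum.cong) auto
qed

lemma is_lse_change_point_le:
  assumes "is_lse_change_point n y k" "1 \<le> j" "j < n"
  shows "1 \<le> k" "k < n" "split_sse n y k \<le> split_sse n y j"
  using assms by (auto simp: is_lse_change_point_def is_arg_min_def not_less)

section \<open>The deviation of the estimator for independent observations\<close>

text \<open>
  The exceptional event collects what \<open>no_overshoot\<close> excludes. Three applications of
  \<open>linear_boundary_crossing\<close> give the first term of the bound: a variable with values \<open>0\<close> and \<open>1 / h\<close> and mean at
  most \<open>G\<close> has variance at most \<open>G / h\<close>. The other two terms come from Markov's inequality at the right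
  edge: with high probability the last \<open>m\<close> cells contain fewer than \<open>A\<close> events and the last \<open>x / h\<close> cells
  contain none. A tail sum over \<open>j < m\<close> cells is then either \<open>0\<close>, or at most \<open>A / h\<close> with \<open>j\<close> larger than \<open>x / h\<close>;
  in both cases its square is at most \<open>A\<^sup>2 / (x h)\<close> times \<open>j\<close>.
\<close>
theorem (in prob_space) overshoot_prob:
  fixes Y :: "nat \<Rightarrow> 'a \<Rightarrow> real"
  assumes indep: "indep_vars (\<lambda>_. borel) Y {1..n}"
    and h: "0 < h" and range: "\<And>i \<omega>. i \<in> {1..n} \<Longrightarrow> \<omega> \<in> space M \<Longrightarrow> Y i \<omega> \<in> {0, 1 / h}"
    and mean: "\<And>i. i \<in> {1..n} \<Longrightarrow> expectation (Y i) = step_mean k0 g1 g2 i"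
    and r: "0 < r" and c: "0 < c" "5 * r \<le> c * \<bar>g2 - g1\<bar>"
    and k0: "c * real n \<le> real k0" "c * real n \<le> real (n - k0)"
    and m: "1 \<le> m" "m \<le> k0" "m \<le> n - k0"
    and G: "0 \<le> g1" "g1 \<le> G" "0 \<le> g2" "g2 \<le> G"
    and pos: "0 < A" "0 < x"
    and large: "A\<^sup>2 / (x * h) + real m * (G + r)\<^sup>2 < c\<^sup>2 * r\<^sup>2 * real n"
  shows "\<exists>E\<in>events. prob E \<le> 6 * G / (h * r\<^sup>2 * real m) + real m * h * G / A + x * G \<and>
    (\<forall>\<omega>\<in>space M - E. \<forall>k. k0 + m \<le> k \<and> k < n \<longrightarrow>
       split_sse n (\<lambda>i. Y i \<omega>) k0 < split_sse n (\<lambda>i. Y i \<omega>) k)"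
proof -
  let ?\<mu> = "step_mean k0 g1 g2"
  have \<mu>: "0 \<le> ?\<mu> i" "?\<mu> i \<le> G" for i using G by (auto simp: step_mean_def)
  have G0: "0 \<le> G" using G by simp
  have Y: "Y i \<in> borel_measurable M" if "i \<in> {1..n}" for i
    using indep that by (auto simp: indep_vars_def2)
  have nonneg: "0 \<le> Y i \<omega>" if "i \<in> {1..n}" "\<omega> \<in> space M" for i \<omega>
    using range[OF that] h by auto
  have int: "integrable M (Y i)" if "i \<in> {1..n}" for i
  proof (rule integrable_const_bound[of _ "1 / h"])
    show "AE \<omega> in M. norm (Y i \<omega>) \<le> 1 / h"
      using range[OF that] h by (intro AE_I2) fastforce
  qed (rule Y[OF that])
  have dev_sq: "(Y i \<omega> - ?\<mu> i)\<^sup>2 = (1 / h - 2 * ?\<mu> i) * Y i \<omega> + (?\<mu> i)\<^sup>2"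
    if "i \<in> {1..n}" "\<omega> \<in> space M" for i \<omega>
    using range[OF that] by (auto simp: power2_eq_square algebra_simps)
  have dev_int: "integrable M (\<lambda>\<omega>. (Y i \<omega> - ?\<mu> i)\<^sup>2)" if "i \<in> {1..n}" for i
    using int[OF that] by (subst Bochner_Integration.integrable_cong[OF refl dev_sq[OF that]]) auto
  have dev_var: "expectation (\<lambda>\<omega>. (Y i \<omega> - ?\<mu> i)\<^sup>2) \<le> G / h" if "i \<in> {1..n}" for i
  proof -
    have "expectation (\<lambda>\<omega>. (Y i \<omega> - ?\<mu> i)\<^sup>2) =
        expectation (\<lambda>\<omega>. (1 / h - 2 * ?\<mu> i) * Y i \<omega> + (?\<mu> i)\<^sup>2)"
      using dev_sq[OF that] by (intro Bochner_Integration.integral_cong) auto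
    also have "\<dots> = (1 / h - 2 * ?\<mu> i) * ?\<mu> i + (?\<mu> i)\<^sup>2"
      using int[OF that] mean[OF that] by (simp add: prob_space)
    also have "\<dots> = ?\<mu> i / h - (?\<mu> i)\<^sup>2"
      by (simp add: power2_eq_square algebra_simps)
    also have "\<dots> \<le> ?\<mu> i / h" by simp
    also have "\<dots> \<le> G / h" using \<mu> h by (intro divide_right_mono) auto
    finally show ?thesis .
  qed
  define leaves where "leaves = (\<lambda>l (\<sigma> :: nat \<Rightarrow> nat). {\<omega>\<in>space M. \<exists>j. m \<le> j \<and> j \<le> l \<and>
    r * real j \<le> \<bar>\<Sum>i<j. (Y (\<sigma> i) \<omega> - ?\<mu> (\<sigma> i))\<bar>})"
  have stay: "\<bar>\<Sum>i<j. (Y (\<sigma> i) \<omega> - ?\<mu> (\<sigma> i))\<bar> < r * real j"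
    if "\<omega> \<in> space M" "\<omega> \<notin> leaves l \<sigma>" "m \<le> j" "j \<le> l" for \<omega> l \<sigma> j
    using that by (force simp: leaves_def)
  have leaves_events: "leaves l \<sigma> \<in> events" if "\<sigma> ` {..<l} \<subseteq> {1..n}" for l \<sigma>
  proof -
    have rng: "\<sigma> i \<in> {1..n}" if "i \<in> {..<j}" "j \<in> {m..l}" for i j
    proof -
      have "i \<in> {..<l}" using that by auto
      thus ?thesis using \<open>\<sigma> ` {..<l} \<subseteq> {1..n}\<close> by blast
    qed
    have "{\<omega>\<in>space M. \<exists>j\<in>{m..l}. r * real j \<le> \<bar>\<Sum>i<j. (Y (\<sigma> i) \<omega> - ?\<mu> (\<sigma> i))\<bar>} \<in> events"
      by (intro sets.sets_Collect_finite_Ex borel_measurable_le borel_measurable_abs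
          borel_measurable_const borel_measurable_sum borel_measurable_diff Y rng)
        auto
    thus ?thesis by (simp only: leaves_def Bex_def atLeastAtMost_iff conj_assoc)
  qed
  have leaves_prob: "prob (leaves l \<sigma>) \<le> 2 * (G / h) / (r\<^sup>2 * real m)"
    if sub: "\<sigma> ` {..<l} \<subseteq> {1..n}" and inj: "inj_on \<sigma> {..<l}" for l \<sigma>
    unfolding leaves_def
  proof (rule linear_boundary_crossing)
    have "indep_vars (\<lambda>_. borel) (\<lambda>i. Y (\<sigma> i)) {..<l}"
      using indep_vars_subset[OF indep sub] inj by (rule indep_vars_reindex_inj)
    thus "indep_vars (\<lambda>_. borel) (\<lambda>i \<omega>. Y (\<sigma> i) \<omega> - ?\<mu> (\<sigma> i)) {..<l}"
      by (rule indep_vars_compose2[where Y = "\<lambda>i y. y - ?\<mu> (\<sigma> i)"]) auto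
    fix i assume "i < l"
    hence i: "\<sigma> i \<in> {1..n}" using sub by auto
    show "integrable M (\<lambda>\<omega>. (Y (\<sigma> i) \<omega> - ?\<mu> (\<sigma> i))\<^sup>2)" using dev_int[OF i] .
    show "expectation (\<lambda>\<omega>. Y (\<sigma> i) \<omega> - ?\<mu> (\<sigma> i)) = 0"
      using int[OF i] mean[OF i] by (simp add: prob_space)
    show "expectation (\<lambda>\<omega>. (Y (\<sigma> i) \<omega> - ?\<mu> (\<sigma> i))\<^sup>2) \<le> G / h" using dev_var[OF i] .
  qed (use G0 h r m in auto)
  have kn: "k0 \<le> n" "m \<le> n" using m by auto
  define E1 E2 E3 where "E1 = leaves n Suc" and "E2 = leaves n (\<lambda>i. n - i)"
    and "E3 = leaves (n - k0) (\<lambda>i. k0 + 1 + i)"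
  have idx: "Suc ` {..<n} \<subseteq> {1..n}" "(\<lambda>i. n - i) ` {..<n} \<subseteq> {1..n}"
    "(\<lambda>i. k0 + 1 + i) ` {..<n - k0} \<subseteq> {1..n}"
    by auto
  have inj: "inj_on Suc {..<n}" "inj_on (\<lambda>i. n - i) {..<n}" "inj_on (\<lambda>i. k0 + 1 + i) {..<n - k0}"
    by (auto simp: inj_on_def)
  define q where "q = nat \<lfloor>x / h\<rfloor>"
  have q: "real q \<le> x / h" "x / h < real q + 1"
    using pos h by (simp_all add: q_def)
  define busy where "busy = (\<lambda>l a. {\<omega>\<in>space M. a / h \<le> (\<Sum>i=n-l+1..n. Y i \<omega>)})"
  have busy_events: "busy l a \<in> events" for l a
    unfolding busy_def
    by (intro borel_measurable_le borel_measurable_const borel_measurable_sum Y) auto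
  have busy_prob: "prob (busy l a) \<le> real l * h * G / a" if a: "0 < a" for l a
  proof -
    have "prob (busy l a) \<le> expectation (\<lambda>\<omega>. \<Sum>i=n-l+1..n. Y i \<omega>) / (a / h)"
      unfolding busy_def
    proof (rule integral_Markov_inequality_measure[where A = "{}"])
      show "integrable M (\<lambda>\<omega>. \<Sum>i=n-l+1..n. Y i \<omega>)"
        by (intro Bochner_Integration.integrable_sum int) auto
      show "AE \<omega> in M. 0 \<le> (\<Sum>i=n-l+1..n. Y i \<omega>)"
        by (intro AE_I2 sum_nonneg nonneg) auto
    qed (use a h in auto)
    also have "expectation (\<lambda>\<omega>. \<Sum>i=n-l+1..n. Y i \<omega>) = (\<Sum>i=n-l+1..n. ?\<mu> i)"
      by (subst Bochner_Integration.integral_sum) (auto intro!: int sum.cong mean)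
    also have "(\<Sum>i=n-l+1..n. ?\<mu> i) / (a / h) \<le> real l * G / (a / h)"
    proof (rule divide_right_mono)
      have "(\<Sum>i=n-l+1..n. ?\<mu> i) \<le> real (card {n-l+1..n}) * G"
        by (rule sum_bounded_above) (rule \<mu>)
      also have "\<dots> \<le> real l * G" using G0 by (intro mult_right_mono) auto
      finally show "(\<Sum>i=n-l+1..n. ?\<mu> i) \<le> real l * G" .
    qed (use a h in auto)
    finally show ?thesis by (simp add: mult_ac)
  qed
  let ?E = "E1 \<union> E2 \<union> E3 \<union> busy m A \<union> busy q 1"
  have "?E \<in> events"
    using leaves_events idx busy_events by (auto simp: E1_def E2_def E3_def)
  moreover have "prob ?E \<le> 6 * G / (h * r\<^sup>2 * real m) + real m * h * G / A + x * G"
  proof -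
    define u where "u = 2 * (G / h) / (r\<^sup>2 * real m)"
    have ev: "E1 \<in> events" "E2 \<in> events" "E3 \<in> events" "busy m A \<in> events" "busy q 1 \<in> events"
      using leaves_events idx busy_events by (auto simp: E1_def E2_def E3_def)
    have "prob ?E \<le> prob E1 + prob E2 + prob E3 + prob (busy m A) + prob (busy q 1)"
      using ev
        measure_Un_le[of "E1 \<union> E2 \<union> E3 \<union> busy m A" M "busy q 1"]
        measure_Un_le[of "E1 \<union> E2 \<union> E3" M "busy m A"]
        measure_Un_le[of "E1 \<union> E2" M "E3"]
        measure_Un_le[of "E1" M "E2"]
      by auto
    also have "\<dots> \<le> u + u + u + real m * h * G / A + x * G"
    proof (intro add_mono)
      show "prob E1 \<le> u" "prob E2 \<le> u" "prob E3 \<le> u"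
        unfolding E1_def E2_def E3_def u_def using leaves_prob idx inj by blast+
      show "prob (busy m A) \<le> real m * h * G / A" by (rule busy_prob[OF pos(1)])
      have "real q * h * G \<le> x * G"
        using q(1) h G0 by (intro mult_right_mono) (auto simp: field_simps)
      thus "prob (busy q 1) \<le> x * G" using busy_prob[of 1 q] by simp
    qed
    also have "u + u + u = 6 * G / (h * r\<^sup>2 * real m)"
      by (simp add: u_def mult_ac)
    finally show ?thesis .
  qed
  moreover have "split_sse n (\<lambda>i. Y i \<omega>) k0 < split_sse n (\<lambda>i. Y i \<omega>) k"
    if \<omega>: "\<omega> \<in> space M - ?E" and k: "k0 + m \<le> k" "k < n" for \<omega> k
  proof (rule no_overshoot[OF r c k0 m k _ G])
    have \<omega>': "\<omega> \<in> space M" using \<omega> by simp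
    show "0 \<le> Y i \<omega>" if "i \<in> {1..n}" for i using nonneg[OF that \<omega>'] .
    show "\<bar>\<Sum>i=1..j. (Y i \<omega> - ?\<mu> i)\<bar> < r * real j" if "m \<le> j" "j \<le> n" for j
    proof -
      have "(\<Sum>i=1..j. (Y i \<omega> - ?\<mu> i)) = (\<Sum>i<j. (Y (Suc i) \<omega> - ?\<mu> (Suc i)))"
        by (rule sum.reindex_bij_witness[of _ Suc "\<lambda>i. i - 1"]) auto
      thus ?thesis using stay[of \<omega> n Suc j] \<omega> that by (simp add: E1_def)
    qed
    show "\<bar>\<Sum>i=n-j+1..n. (Y i \<omega> - ?\<mu> i)\<bar> < r * real j" if "m \<le> j" "j \<le> n" for j
    proof -
      have "(\<Sum>i=n-j+1..n. (Y i \<omega> - ?\<mu> i)) = (\<Sum>i<j. (Y (n - i) \<omega> - ?\<mu> (n - i)))"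
        by (rule sum.reindex_bij_witness[of _ "\<lambda>i. n - i" "\<lambda>i. n - i"]) (use that in auto)
      thus ?thesis using stay[of \<omega> n "\<lambda>i. n - i" j] \<omega> that by (simp add: E2_def)
    qed
    show "\<bar>\<Sum>i=k0+1..k0+j. (Y i \<omega> - ?\<mu> i)\<bar> < r * real j" if "m \<le> j" "j \<le> n - k0" for j
    proof -
      have "(\<Sum>i=k0+1..k0+j. (Y i \<omega> - ?\<mu> i)) = (\<Sum>i<j. (Y (k0 + 1 + i) \<omega> - ?\<mu> (k0 + 1 + i)))"
        by (rule sum.reindex_bij_witness[of _ "\<lambda>i. k0 + 1 + i" "\<lambda>i. i - (k0 + 1)"]) auto
      thus ?thesis using stay[of \<omega> "n - k0" "\<lambda>i. k0 + 1 + i" j] \<omega> that by (simp add: E3_def)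
    qed
    show "(\<Sum>i=n-j+1..n. Y i \<omega>)\<^sup>2 \<le> A\<^sup>2 / (x * h) * real j" if j: "1 \<le> j" "j < m" for j
    proof (cases "j \<le> q")
      case True
      have "(\<Sum>i=n-j+1..n. Y i \<omega>) \<le> (\<Sum>i=n-q+1..n. Y i \<omega>)"
        using True by (intro sum_mono2 nonneg \<omega>') auto
      also have "\<dots> < 1 / h" using \<omega> by (auto simp: busy_def not_le)
      finally have small: "(\<Sum>i=n-j+1..n. Y i \<omega>) < 1 / h" .
      have "Y i \<omega> = 0" if i: "i \<in> {n-j+1..n}" for i
      proof (rule ccontr)
        have i': "i \<in> {1..n}" using i by auto
        assume "Y i \<omega> \<noteq> 0"
        hence "1 / h = Y i \<omega>" using range[OF i' \<omega>'] by auto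
        also have "\<dots> \<le> (\<Sum>i=n-j+1..n. Y i \<omega>)"
          using i by (intro member_le_sum nonneg \<omega>') auto
        finally show False using small by simp
      qed
      hence "(\<Sum>i=n-j+1..n. Y i \<omega>) = 0" by simp
      thus ?thesis using pos h by simp
    next
      case False
      have "(\<Sum>i=n-j+1..n. Y i \<omega>) \<le> (\<Sum>i=n-m+1..n. Y i \<omega>)"
        using j by (intro sum_mono2 nonneg \<omega>') auto
      also have "\<dots> \<le> A / h" using \<omega> by (auto simp: busy_def not_le)
      finally have "(\<Sum>i=n-j+1..n. Y i \<omega>)\<^sup>2 \<le> (A / h)\<^sup>2"
        by (intro power_mono sum_nonneg nonneg \<omega>') auto
      also have "\<dots> = A\<^sup>2 / (x * h) * (x / h)"
        using pos h by (simp add: power2_eq_square)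
      also have "\<dots> \<le> A\<^sup>2 / (x * h) * real j"
      proof (rule mult_left_mono)
        show "x / h \<le> real j" using False q(2) by linarith
      qed (use pos h in auto)
      finally show ?thesis .
    qed
    show "A\<^sup>2 / (x * h) + real m * (G + r)\<^sup>2 < c\<^sup>2 * r\<^sup>2 * real n" by (rule large)
  qed
  ultimately show ?thesis by blast
qed

text \<open>
  \<open>overshoot_prob\<close> applied to the sequence and to its time reversal, for which the two levels change
  places.
\<close>
theorem (in prob_space) lse_deviation_prob:
  fixes Y :: "nat \<Rightarrow> 'a \<Rightarrow> real"
  assumes indep: "indep_vars (\<lambda>_. borel) Y {1..n}"
    and h: "0 < h" and range: "\<And>i \<omega>. i \<in> {1..n} \<Longrightarrow> \<omega> \<in> space M \<Longrightarrow> Y i \<omega> \<in> {0, 1 / h}"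
    and mean: "\<And>i. i \<in> {1..n} \<Longrightarrow> expectation (Y i) = step_mean k0 g1 g2 i"
    and r: "0 < r" and c: "0 < c" "5 * r \<le> c * \<bar>g2 - g1\<bar>"
    and k0: "c * real n \<le> real k0" "c * real n \<le> real (n - k0)"
    and m: "1 \<le> m" "m \<le> k0" "m \<le> n - k0"
    and G: "0 \<le> g1" "g1 \<le> G" "0 \<le> g2" "g2 \<le> G"
    and pos: "0 < A" "0 < x"
    and large: "A\<^sup>2 / (x * h) + real m * (G + r)\<^sup>2 < c\<^sup>2 * r\<^sup>2 * real n"
  shows "\<exists>E\<in>events. prob E \<le> 2 * (6 * G / (h * r\<^sup>2 * real m) + real m * h * G / A + x * G) \<and>
    (\<forall>\<omega>\<in>space M - E. \<forall>k. is_lse_change_point n (\<lambda>i. Y i \<omega>) k \<longrightarrow> \<bar>real k - real k0\<bar> < real m)"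
proof -
  let ?b = "6 * G / (h * r\<^sup>2 * real m) + real m * h * G / A + x * G"
  obtain E where E: "E \<in> events" "prob E \<le> ?b"
    "\<And>\<omega> k. \<omega> \<in> space M - E \<Longrightarrow> k0 + m \<le> k \<Longrightarrow> k < n \<Longrightarrow>
      split_sse n (\<lambda>i. Y i \<omega>) k0 < split_sse n (\<lambda>i. Y i \<omega>) k"
    using overshoot_prob[OF indep h range mean r c k0 m G pos large] by blast
  have kn: "k0 < n" "0 < k0" using m by auto
  have rev_img: "(\<lambda>i. n + 1 - i) ` {1..n} \<subseteq> {1..n}" by auto
  have rev_indep: "indep_vars (\<lambda>_. borel) (\<lambda>i. Y (n + 1 - i)) {1..n}"
    by (rule indep_vars_reindex_inj[OF indep_vars_subset[OF indep rev_img]]) (auto simp: inj_on_def)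
  have rev_range: "Y (n + 1 - i) \<omega> \<in> {0, 1 / h}" if "i \<in> {1..n}" "\<omega> \<in> space M" for i \<omega>
    by (rule range) (use that in auto)
  have rev_mean: "expectation (Y (n + 1 - i)) = step_mean (n - k0) g2 g1 i" if "i \<in> {1..n}" for i
  proof -
    have "n + 1 - i \<in> {1..n}" "n + 1 - i \<le> k0 \<longleftrightarrow> \<not> i \<le> n - k0" using that kn by auto
    thus ?thesis using mean[of "n + 1 - i"] by (simp add: step_mean_def)
  qed
  have rev_k0: "c * real n \<le> real (n - k0)" "c * real n \<le> real (n - (n - k0))"
    "m \<le> n - k0" "m \<le> n - (n - k0)"
    using k0 m kn by auto
  have rev_c: "5 * r \<le> c * \<bar>g1 - g2\<bar>" using c(2) by (simp add: abs_minus_commute)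
  obtain F where F: "F \<in> events" "prob F \<le> ?b"
    "\<And>\<omega> k. \<omega> \<in> space M - F \<Longrightarrow> n - k0 + m \<le> k \<Longrightarrow> k < n \<Longrightarrow>
      split_sse n (\<lambda>i. Y (n + 1 - i) \<omega>) (n - k0) < split_sse n (\<lambda>i. Y (n + 1 - i) \<omega>) k"
    using overshoot_prob[OF rev_indep h rev_range rev_mean r c(1) rev_c rev_k0(1,2) m(1) rev_k0(3,4)
        G(3,4,1,2) pos large] by blast
  show ?thesis
  proof (intro bexI[of _ "E \<union> F"] conjI ballI allI impI)
    show "E \<union> F \<in> events" using E F by auto
    show "prob (E \<union> F) \<le> 2 * ?b"
      unfolding mult_2
      by (rule order_trans[OF measure_Un_le[OF E(1) F(1)] add_mono[OF E(2) F(2)]])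
    fix \<omega> k assume \<omega>: "\<omega> \<in> space M - (E \<union> F)" and lse: "is_lse_change_point n (\<lambda>i. Y i \<omega>) k"
    note k = is_lse_change_point_le[OF lse, of k0]
    have "\<not> k0 + m \<le> k" using E(3)[of \<omega> k] \<omega> k kn by fastforce
    moreover have "\<not> k + m \<le> k0"
    proof
      assume "k + m \<le> k0"
      hence "n - k0 + m \<le> n - k" "n - k < n" using kn k by auto
      hence "split_sse n (\<lambda>i. Y (n + 1 - i) \<omega>) (n - k0) < split_sse n (\<lambda>i. Y (n + 1 - i) \<omega>) (n - k)"
        using F(3) \<omega> by blast
      thus False
        using k kn split_sse_reverse[of k0 n "\<lambda>i. Y i \<omega>"] split_sse_reverse[of k n "\<lambda>i. Y i \<omega>"]
        by simp
    qed
    ultimately show "\<bar>real k - real k0\<bar> < real m" by auto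
  qed
qed

section \<open>Displacements of the telegraph process\<close>

text \<open>
  For \<open>n \<le> K\<close>, \<open>(- 1) ^ n\<close> is a fixed combination of the indicators \<open>k < n\<close> with \<open>k < K\<close>, and along a monotone
  path each indicator is monotone.
\<close>
lemma parity_integrable:
  assumes mono: "mono_on {s..t} N"
  shows "(\<lambda>u. (- 1 :: real) ^ N u) integrable_on {s..t :: real}"
proof -
  have expand: "(- 1 :: real) ^ n = 1 + (\<Sum>k<K. 2 * (- 1) ^ Suc k * of_bool (k < n))"
    if "n \<le> K" for n K :: nat
  proof -
    have "(\<Sum>k<K. 2 * (- 1 :: real) ^ Suc k * of_bool (k < n)) = (\<Sum>k<n. 2 * (- 1) ^ Suc k)"
      by (rule sum.mono_neutral_cong_right) (use that in auto)
    moreover have "(- 1 :: real) ^ n = 1 + (\<Sum>k<n. 2 * (- 1) ^ Suc k)"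
      by (induction n) auto
    ultimately show ?thesis by simp
  qed
  have "(\<lambda>u. 1 + (\<Sum>k<N t. 2 * (- 1 :: real) ^ Suc k * of_bool (k < N u))) integrable_on {s..t}"
  proof (intro integrable_add integrable_sum integrable_const_ivl integrable_on_mult_right)
    show "(\<lambda>u. of_bool (k < N u) :: real) integrable_on {s..t}" for k
      by (rule integrable_on_mono_on) (use mono in \<open>fastforce simp: mono_on_def\<close>)
  qed auto
  thus ?thesis
  proof (rule integrable_eq)
    fix u assume "u \<in> {s..t}"
    hence "N u \<le> N t" using mono by (auto simp: mono_on_def)
    thus "1 + (\<Sum>k<N t. 2 * (- 1 :: real) ^ Suc k * of_bool (k < N u)) = (- 1) ^ N u"
      by (rule expand[symmetric])
  qed
qed

lemma integral_lt_of_dip: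
  fixes f :: "real \<Rightarrow> real"
  assumes int: "f integrable_on {s..t}" and le: "\<And>u. u \<in> {s..t} \<Longrightarrow> f u \<le> 1"
    and ab: "s \<le> a" "a < b" "b \<le> t" and dip: "\<And>u. u \<in> {a..b} \<Longrightarrow> f u = - 1"
  shows "integral {s..t} f < t - s"
proof -
  have at: "a \<le> t" using ab by simp
  have le': "integral {p..q} f \<le> q - p" if "s \<le> p" "p \<le> q" "q \<le> t" for p q
  proof -
    have "integral {p..q} f \<le> integral {p..q} (\<lambda>_. 1)"
    proof (rule integral_le)
      show "f integrable_on {p..q}"
        by (rule integrable_on_subinterval[OF int]) (use that in auto)
    qed (use le that in auto)
    thus ?thesis using that by simp
  qed
  have "integral {a..b} f = integral {a..b} (\<lambda>_. - 1)"
    by (rule Henstock_Kurzweil_Integration.integral_cong) (use dip in auto)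
  hence "integral {a..b} f = - (b - a)" using ab by simp
  moreover have "integral {s..t} f = integral {s..a} f + integral {a..t} f"
    using Henstock_Kurzweil_Integration.integral_combine[OF ab(1) at int] by simp
  moreover have "integral {a..t} f = integral {a..b} f + integral {b..t} f"
  proof -
    have "f integrable_on {a..t}"
      by (rule integrable_on_subinterval[OF int]) (use ab in auto)
    from Henstock_Kurzweil_Integration.integral_combine[OF _ ab(3) this] ab show ?thesis by simp
  qed
  ultimately show ?thesis using le'[of s a] le'[of b t] ab by simp
qed

text \<open>
  Right continuity for the discrete topology of the naturals: each value is held for a positive time.
\<close>
lemma locally_constant_right:
  fixes N :: "real \<Rightarrow> nat"
  assumes "continuous (at_right a) N" "a < t"
  obtains b where "a < b" "b \<le> t" "\<And>u. u \<in> {a..b} \<Longrightarrow> N u = N a"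
proof -
  have "(N \<longlongrightarrow> N a) (at_right a)"
    using assms(1) by (simp add: continuous_within)
  moreover have "open {N a}" by (rule Topological_Spaces.open_discrete)
  ultimately have "eventually (\<lambda>u. N u \<in> {N a}) (at_right a)"
    by (rule topological_tendstoD) simp
  then obtain c where c: "c > a" "\<And>u. a < u \<Longrightarrow> u < c \<Longrightarrow> N u = N a"
    by (auto simp: eventually_at_right_field)
  show thesis
  proof (rule that[of "min ((a + c) / 2) t"])
    show "N u = N a" if "u \<in> {a..min ((a + c) / 2) t}" for u
      using that c by (cases "u = a") auto
  qed (use c assms(2) in auto)
qed

lemma abs_parity_integral_const:
  assumes mono: "mono_on {s..t} N" and "s \<le> t" and eq: "N t = N s"
  shows "\<bar>integral {s..t} (\<lambda>u. (- 1 :: real) ^ N u)\<bar> = t - s"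
proof -
  have const: "N u = N s" if "u \<in> {s..t}" for u
    using mono_onD[OF mono, of s u] mono_onD[OF mono, of u t] eq that assms(2) by simp
  have "integral {s..t} (\<lambda>u. (- 1 :: real) ^ N u) = integral {s..t} (\<lambda>u. (- 1) ^ N s)"
    by (rule Henstock_Kurzweil_Integration.integral_cong) (simp only: const)
  thus ?thesis using assms(2) by (simp add: abs_mult power_abs)
qed

text \<open>
  Both signs are attained, hence each is held on an interval of positive length, which keeps the integral
  away from both extreme values. The times must lie strictly before \<open>t\<close>: a value taken only at \<open>t\<close> does not
  affect the integral.
\<close>
lemma abs_parity_integral_less:
  assumes mono: "mono_on {s..t} N"
    and cont: "\<And>a. a \<in> {s..<t} \<Longrightarrow> continuous (at_right a) N"
    and a: "a \<in> {s..<t}" "even (N a)" and b: "b \<in> {s..<t}" "odd (N b)"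
  shows "\<bar>integral {s..t} (\<lambda>u. (- 1 :: real) ^ N u)\<bar> < t - s"
proof -
  let ?f = "\<lambda>u. (- 1 :: real) ^ N u"
  have int: "?f integrable_on {s..t}" by (rule parity_integrable[OF mono])
  have bnd: "\<bar>?f u\<bar> \<le> 1" for u by (simp add: power_abs)
  obtain c where c: "b < c" "c \<le> t" "\<And>u. u \<in> {b..c} \<Longrightarrow> N u = N b"
    using locally_constant_right[OF cont[OF b(1)], of t] b(1) by auto
  have upper: "integral {s..t} ?f < t - s"
  proof (rule integral_lt_of_dip[OF int _ _ c(1,2)])
    show "?f u \<le> 1" for u using bnd[of u] by linarith
    show "s \<le> b" using b(1) by simp
    show "?f u = - 1" if "u \<in> {b..c}" for u using c(3)[OF that] b(2) by simp
  qed
  obtain d where d: "a < d" "d \<le> t" "\<And>u. u \<in> {a..d} \<Longrightarrow> N u = N a"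
    using locally_constant_right[OF cont[OF a(1)], of t] a(1) by auto
  have "integral {s..t} (\<lambda>u. - ?f u) < t - s"
  proof (rule integral_lt_of_dip[OF _ _ _ d(1,2)])
    show "(\<lambda>u. - ?f u) integrable_on {s..t}" using int by (rule integrable_neg)
    show "- ?f u \<le> 1" for u using bnd[of u] by linarith
    show "s \<le> a" using a(1) by simp
    show "- ?f u = - 1" if "u \<in> {a..d}" for u using d(3)[OF that] a(2) by simp
  qed
  thus ?thesis using upper by simp
qed

context prob_space
begin

text \<open>
  The second bound is \<open>1 - (1 + x) exp (- x) \<le> 1 - (1 + x) (1 - x) = x\<^sup>2\<close>.
\<close>
lemma poisson_increment_prob:
  assumes N: "inhom_poisson_process T lam N" and st: "0 \<le> s" "s < t" "t \<le> T"
    and x: "integral {s..t} lam = x" "0 \<le> x"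
  shows poisson_increment_events: "{\<omega>\<in>space M. P (N t \<omega> - N s \<omega>)} \<in> events"
    and poisson_prob_ge_1: "prob {\<omega>\<in>space M. 1 \<le> N t \<omega> - N s \<omega>} = 1 - exp (- x)"
    and poisson_prob_ge_2: "prob {\<omega>\<in>space M. 2 \<le> N t \<omega> - N s \<omega>} \<le> x\<^sup>2"
proof -
  have [measurable]: "random_variable (count_space UNIV) (N t)"
    "random_variable (count_space UNIV) (N s)"
    using N st by (auto simp: inhom_poisson_process_def)
  have ev: "{\<omega>\<in>space M. P (N t \<omega> - N s \<omega>)} \<in> events" for P by measurable
  thus "{\<omega>\<in>space M. P (N t \<omega> - N s \<omega>)} \<in> events" .
  have p: "prob {\<omega>\<in>space M. N t \<omega> - N s \<omega> = j} = x ^ j / fact j * exp (- x)" for j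
    using N st x by (auto simp: inhom_poisson_process_def)
  have "{\<omega>\<in>space M. 1 \<le> N t \<omega> - N s \<omega>} = space M - {\<omega>\<in>space M. N t \<omega> - N s \<omega> = 0}" by auto
  thus "prob {\<omega>\<in>space M. 1 \<le> N t \<omega> - N s \<omega>} = 1 - exp (- x)"
    using prob_compl[OF ev, of "\<lambda>j. j = 0"] p[of 0] by simp
  have "{\<omega>\<in>space M. 2 \<le> N t \<omega> - N s \<omega>} = space M -
      ({\<omega>\<in>space M. N t \<omega> - N s \<omega> = 0} \<union> {\<omega>\<in>space M. N t \<omega> - N s \<omega> = 1})"
    by auto
  hence "prob {\<omega>\<in>space M. 2 \<le> N t \<omega> - N s \<omega>} =
      1 - prob ({\<omega>\<in>space M. N t \<omega> - N s \<omega> = 0} \<union> {\<omega>\<in>space M. N t \<omega> - N s \<omega> = 1})"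
    using prob_compl[OF sets.Un[OF ev ev], of "\<lambda>j. j = 0" "\<lambda>j. j = 1"] by simp
  also have "\<dots> = 1 - (1 + x) * exp (- x)"
    by (subst finite_measure_Union[OF ev ev]) (auto simp: p[of 0, simplified] p[of 1, simplified] algebra_simps)
  also have "\<dots> \<le> 1 - (1 + x) * (1 - x)"
    using x exp_ge_add_one_self[of "- x"] by (intro diff_left_mono mult_left_mono) auto
  finally show "prob {\<omega>\<in>space M. 2 \<le> N t \<omega> - N s \<omega>} \<le> x\<^sup>2"
    by (simp add: power2_eq_square algebra_simps)
qed

text \<open>
  A substitute for the fact that Poisson paths have unit jumps and no jump at a fixed time. The failure
  probability for the partition into \<open>m + 1\<close> pieces of mean \<open>x\<close> each is at most \<open>x + (m + 1) x\<^sup>2\<close>, which is of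
  order \<open>1 / (m + 1)\<close>; so almost surely some partition succeeds.
\<close>
lemma AE_fine_partition:
  assumes N: "inhom_poisson_process T lam N" and st: "0 \<le> s" "s < t" "t \<le> T"
    and rate: "0 \<le> \<mu>" "\<And>a b. s \<le> a \<Longrightarrow> a < b \<Longrightarrow> b \<le> t \<Longrightarrow> integral {a..b} lam = \<mu> * (b - a)"
  defines "p \<equiv> \<lambda>m r. s + real r * ((t - s) / real (Suc m))"
  shows "AE \<omega> in M. \<exists>m. N t \<omega> - N (p m m) \<omega> < 1 \<and>
    (\<forall>r\<le>m. N (p m (Suc r)) \<omega> - N (p m r) \<omega> < 2)"
proof -
  have p: "s \<le> p m r" "p m r < p m (Suc r)" "p m (Suc r) \<le> t"
    "p m (Suc r) - p m r = (t - s) / real (Suc m)" if "r \<le> m" for m r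
  proof -
    define d where "d = (t - s) / real (Suc m)"
    have d: "0 < d" using st by (simp add: d_def)
    have p_eq: "p m k = s + real k * d" for k by (simp only: p_def d_def)
    show "s \<le> p m r" "p m r < p m (Suc r)"
      using d by (simp_all add: p_eq distrib_right)
    have "real (Suc r) * d \<le> real (Suc m) * d"
      using d that by (intro mult_right_mono) auto
    also have "\<dots> = t - s" by (simp add: d_def)
    finally show "p m (Suc r) \<le> t" by (simp add: p_eq)
    show "p m (Suc r) - p m r = (t - s) / real (Suc m)"
      unfolding d_def[symmetric] by (simp add: p_eq distrib_right)
  qed
  have pt: "p m (Suc m) = t" for m by (simp add: p_def)
  define x where "x = (\<lambda>m. \<mu> * ((t - s) / real (Suc m)))"
  have x: "integral {p m r..p m (Suc r)} lam = x m" "0 \<le> x m" if "r \<le> m" for m r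
    using rate p[OF that] st unfolding x_def by auto
  have stp: "0 \<le> p m r" "p m r < p m (Suc r)" "p m (Suc r) \<le> T" if "r \<le> m" for m r
    using p[OF that] st by auto
  define A where "A = (\<lambda>m. {\<omega>\<in>space M. 1 \<le> N (p m (Suc m)) \<omega> - N (p m m) \<omega>})"
  define B where "B = (\<lambda>m r. {\<omega>\<in>space M. 2 \<le> N (p m (Suc r)) \<omega> - N (p m r) \<omega>})"
  define bad where "bad = (\<lambda>m. A m \<union> (\<Union>r\<in>{..m}. B m r))"
  have A: "A m \<in> events" for m
    unfolding A_def by (rule poisson_increment_events[OF N stp x]) auto
  have B: "B m r \<in> events" if "r \<le> m" for m r
    unfolding B_def by (rule poisson_increment_events[OF N stp x]) (use that in auto)
  have bad: "bad m \<in> events" for m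
    unfolding bad_def using A B by (intro sets.Un sets.finite_UN) auto
  define K where "K = \<mu> * (t - s) + (\<mu> * (t - s))\<^sup>2"
  have bad_prob: "prob (bad m) \<le> K / real (Suc m)" for m
  proof -
    have "prob (bad m) \<le> prob (A m) + prob (\<Union>r\<in>{..m}. B m r)"
      unfolding bad_def using A B by (intro measure_Un_le sets.finite_UN) auto
    also have "prob (\<Union>r\<in>{..m}. B m r) \<le> (\<Sum>r\<in>{..m}. prob (B m r))"
      using B by (intro finite_measure_subadditive_finite) auto
    also have "\<dots> \<le> (\<Sum>r\<in>{..m}. (x m)\<^sup>2)"
      unfolding B_def by (intro sum_mono poisson_prob_ge_2[OF N stp x]) auto
    also have "\<dots> = real (Suc m) * (x m)\<^sup>2" by simp
    also have "prob (A m) = 1 - exp (- x m)"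
      unfolding A_def by (rule poisson_prob_ge_1[OF N stp x]) auto
    also have "1 - exp (- x m) \<le> x m"
      using exp_ge_add_one_self[of "- x m"] by simp
    also have "x m + real (Suc m) * (x m)\<^sup>2 = K / real (Suc m)"
      by (simp add: x_def K_def power2_eq_square add_divide_distrib)
    finally show ?thesis by simp
  qed
  have "prob (\<Inter>m. bad m) \<le> 0"
  proof (rule LIMSEQ_le_const)
    show "(\<lambda>m. K / real (Suc m)) \<longlonglongrightarrow> 0"
      by (rule LIMSEQ_Suc[OF lim_const_over_n])
    have "prob (\<Inter>m. bad m) \<le> K / real (Suc m)" for m
      by (rule order_trans[OF finite_measure_mono[OF _ bad] bad_prob]) auto
    thus "\<exists>m0. \<forall>m\<ge>m0. prob (\<Inter>m. bad m) \<le> K / real (Suc m)" by blast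
  qed
  moreover have "(\<Inter>m. bad m) \<in> events" using bad by (intro sets.countable_INT) auto
  ultimately have "AE \<omega> in M. \<omega> \<notin> (\<Inter>m. bad m)"
    using prob_eq_0 measure_nonneg[of M "\<Inter>m. bad m"] by (metis order_antisym)
  thus ?thesis
    by (rule AE_mp) (auto simp: bad_def A_def B_def pt not_le intro!: AE_I2)
qed

text \<open>
  Without an event the velocity is constant and the displacement maximal. Conversely, a maximal displacement
  forces the parity of \<open>N\<close> to be constant on \<open>[s, t)\<close>. This leaves room for jumps of even size and for a
  jump at time \<open>t\<close>, which \<open>AE_fine_partition\<close> excludes: the increments over all pieces but the last are even and
  below 2, and the last one vanishes.
\<close>
theorem increment_detects_events:
  assumes X: "telegraph_data v T lam V N" and v: "0 < v" and st: "0 \<le> s" "s < t" "t \<le> T"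
    and rate: "0 \<le> \<mu>" "\<And>a b. s \<le> a \<Longrightarrow> a < b \<Longrightarrow> b \<le> t \<Longrightarrow> integral {a..b} lam = \<mu> * (b - a)"
  shows "AE \<omega> in M. \<bar>telegraph V N t \<omega> - telegraph V N s \<omega>\<bar> < v * (t - s) \<longleftrightarrow>
    1 \<le> N t \<omega> - N s \<omega>"
proof -
  have N: "inhom_poisson_process T lam N" using X by (simp add: telegraph_data_def)
  have [measurable]: "random_variable borel V" using X by (simp add: telegraph_data_def)
  define p where "p = (\<lambda>m r. s + real r * ((t - s) / real (Suc m)))"
  have "prob ({\<omega>\<in>space M. V \<omega> = v} \<union> {\<omega>\<in>space M. V \<omega> = - v}) = 1"
    by (subst finite_measure_Union) (use X v in \<open>auto simp: telegraph_data_def\<close>)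
  from AE_prob_1[OF this] have "AE \<omega> in M. \<bar>V \<omega>\<bar> = v"
    using v by (auto elim: eventually_mono)
  moreover have "AE \<omega> in M. \<exists>m. N t \<omega> - N (p m m) \<omega> < 1 \<and>
      (\<forall>r\<le>m. N (p m (Suc r)) \<omega> - N (p m r) \<omega> < 2)"
    unfolding p_def by (rule AE_fine_partition[OF N st rate(1)]) (rule rate(2))
  moreover have "AE \<omega> in M. \<omega> \<in> space M" by (rule AE_space)
  ultimately show ?thesis
  proof eventually_elim
    case (elim \<omega>)
    let ?N = "\<lambda>u. N u \<omega>"
    let ?f = "\<lambda>u. (- 1 :: real) ^ ?N u"
    have cont: "continuous (at_right u) ?N" if "u \<in> {0..<T}" for u
      using N elim(3) that by (auto simp: inhom_poisson_process_def)
    have mono: "mono_on {0..T} ?N" using N elim(3) by (auto simp: inhom_poisson_process_def)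
    have mono_st: "mono_on {s..t} ?N" by (rule mono_on_subset[OF mono]) (use st in auto)
    have le: "?N a \<le> ?N b" if "s \<le> a" "a \<le> b" "b \<le> t" for a b
      by (rule mono_onD[OF mono_st]) (use that in auto)
    have "?f integrable_on {0..t}"
      by (rule parity_integrable[OF mono_on_subset[OF mono]]) (use st in auto)
    hence "integral {0..s} ?f + integral {s..t} ?f = integral {0..t} ?f"
      by (rule Henstock_Kurzweil_Integration.integral_combine[rotated 2]) (use st in auto)
    hence "telegraph V N t \<omega> - telegraph V N s \<omega> = V \<omega> * integral {s..t} ?f"
      by (simp add: telegraph_def right_diff_distrib[symmetric])
    hence inc: "\<bar>telegraph V N t \<omega> - telegraph V N s \<omega>\<bar> = v * \<bar>integral {s..t} ?f\<bar>"
      using elim(1) by (simp add: abs_mult)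
    show ?case
    proof
      assume "\<bar>telegraph V N t \<omega> - telegraph V N s \<omega>\<bar> < v * (t - s)"
      hence "\<bar>integral {s..t} ?f\<bar> \<noteq> t - s" unfolding inc by auto
      hence "?N t \<noteq> ?N s" using abs_parity_integral_const[OF mono_st] st by auto
      thus "1 \<le> ?N t - ?N s" using le[of s t] st by auto
    next
      assume jump: "1 \<le> ?N t - ?N s"
      obtain m where last: "?N t - ?N (p m m) < 1"
        and single: "\<And>r. r \<le> m \<Longrightarrow> ?N (p m (Suc r)) - ?N (p m r) < 2"
        using elim(2) by blast
      have p: "s \<le> p m r" "p m r < t" if "r \<le> m" for r
      proof -
        define d where "d = (t - s) / real (Suc m)"
        have d: "0 < d" using st by (simp add: d_def)
        have p_eq: "p m k = s + real k * d" for k by (simp only: p_def d_def)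
        show "s \<le> p m r" using d by (simp add: p_eq)
        have "real r * d < real (Suc m) * d"
          using d that by (intro mult_strict_right_mono) auto
        also have "\<dots> = t - s" by (simp add: d_def)
        finally show "p m r < t" by (simp add: p_eq)
      qed
      have step: "p m r \<le> p m (Suc r)" for r
        using st by (simp add: p_def divide_right_mono mult_right_mono)
      have "\<exists>u\<in>{s..<t}. even (?N u) \<noteq> even (?N s)"
      proof (rule ccontr)
        assume "\<not> ?thesis"
        hence par: "even (?N u) = even (?N s)" if "u \<in> {s..<t}" for u using that by blast
        have "?N (p m r) = ?N s" if "r \<le> m" for r
          using that
        proof (induction r)
          case (Suc r)
          have "?N (p m r) = ?N s" using Suc by simp
          moreover have "?N (p m r) \<le> ?N (p m (Suc r))"
            using p[of r] p[of "Suc r"] step[of r] Suc.prems by (intro le) auto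
          moreover have "even (?N (p m (Suc r))) = even (?N s)"
            using p[of "Suc r"] Suc.prems by (intro par) auto
          moreover have "?N (p m (Suc r)) - ?N (p m r) < 2" using single[of r] Suc.prems by simp
          ultimately show ?case by presburger
        qed (simp add: p_def)
        from this[of m] last jump show False by simp
      qed
      then obtain u where u: "u \<in> {s..<t}" "even (?N u) \<noteq> even (?N s)" by blast
      have s: "s \<in> {s..<t}" using st by simp
      have cont': "continuous (at_right a) ?N" if "a \<in> {s..<t}" for a
        using cont[of a] that st by auto
      have "\<bar>integral {s..t} ?f\<bar> < t - s"
        using abs_parity_integral_less[OF mono_st cont' s _ u(1)]
          abs_parity_integral_less[OF mono_st cont' u(1) _ s] u(2) by blast
      thus "\<bar>telegraph V N t \<omega> - telegraph V N s \<omega>\<bar> < v * (t - s)"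
        unfolding inc using v by simp
    qed
  qed
qed

end

section \<open>The observed variables\<close>

lemma change_intensity_integral_before:
  assumes "a \<le> b" "b \<le> \<theta>"
  shows "integral {a..b} (change_intensity l1 l2 \<theta>) = l1 * (b - a)"
proof -
  have "integral {a..b} (change_intensity l1 l2 \<theta>) = integral {a..b} (\<lambda>_. l1)"
    by (rule Henstock_Kurzweil_Integration.integral_cong)
      (use assms in \<open>auto simp: change_intensity_def\<close>)
  thus ?thesis using assms by simp
qed

lemma change_intensity_integral_after:
  assumes "a \<le> b" "\<theta> \<le> a"
  shows "integral {a..b} (change_intensity l1 l2 \<theta>) = l2 * (b - a)"
proof -
  have "integral {a..b} (change_intensity l1 l2 \<theta>) = integral {a..b} (\<lambda>_. l2)"
    by (rule integral_spike[of "{a}"]) (use assms in \<open>auto simp: change_intensity_def\<close>)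
  thus ?thesis using assms by simp
qed

lemma gamma_mean_bounds:
  assumes "0 < h" "0 \<le> l"
  shows "0 \<le> gamma_mean l h" "gamma_mean l h \<le> l"
proof -
  show "0 \<le> gamma_mean l h" using assms by (simp add: gamma_mean_def)
  have "1 - exp (- (l * h)) \<le> l * h" using exp_ge_add_one_self[of "- (l * h)"] by simp
  thus "gamma_mean l h \<le> l" using assms by (simp add: gamma_mean_def field_simps)
qed

lemma gamma_mean_tendsto: "((\<lambda>h. gamma_mean l h) \<longlongrightarrow> l) (at 0)"
proof -
  have "((\<lambda>h. 1 - exp (- l * h)) has_real_derivative l) (at 0)"
    by (auto intro!: derivative_eq_intros)
  thus ?thesis by (simp add: DERIV_def gamma_mean_def)
qed

text \<open>
  The value that \<open>switch_var\<close> takes almost surely. The two differ, for example, on a path whose only jump in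
  the cell occurs at its right end point.
\<close>
definition jump_var :: "real \<Rightarrow> (real \<Rightarrow> 'a \<Rightarrow> nat) \<Rightarrow> nat \<Rightarrow> 'a \<Rightarrow> real" where
  "jump_var h N i \<omega> =
     (if 1 \<le> N (real i * h) \<omega> - N (real (i - 1) * h) \<omega> then 1 else 0) / h"

text \<open>
  Because the change occurs at a grid point, the intensity is constant on each cell up to its left end
  point, so no cell mixes the two means.
\<close>
lemma (in prob_space) telegraph_jump_vars:
  assumes X: "telegraph_data v (real n * h) (change_intensity l1 l2 (real k0 * h)) V N"
    and v: "0 < v" and h: "0 < h" and rates: "0 \<le> l1" "0 \<le> l2"
  shows jump_var_indep: "indep_vars (\<lambda>_. borel) (jump_var h N) {1..n}"
    and jump_var_mean: "\<And>i. i \<in> {1..n} \<Longrightarrow>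
      expectation (jump_var h N i) = step_mean k0 (gamma_mean l1 h) (gamma_mean l2 h) i"
    and AE_switch_var_eq_jump_var: "AE \<omega> in M. \<forall>i\<in>{1..n}.
      switch_var v h (\<lambda>i. telegraph V N (real i * h) \<omega>) i = jump_var h N i \<omega>"
proof -
  have N: "inhom_poisson_process (real n * h) (change_intensity l1 l2 (real k0 * h)) N"
    using X by (simp add: telegraph_data_def)
  define \<mu> where "\<mu> = step_mean k0 l1 l2"
  have \<mu>: "0 \<le> \<mu> i" for i using rates by (simp add: \<mu>_def step_mean_def)
  have cell: "0 \<le> real (i - 1) * h" "real (i - 1) * h < real i * h" "real i * h \<le> real n * h"
    "real i * h - real (i - 1) * h = h" if "i \<in> {1..n}" for i
    using that h by (auto simp: of_nat_diff algebra_simps)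
  have rate: "integral {a..b} (change_intensity l1 l2 (real k0 * h)) = \<mu> i * (b - a)"
    if "i \<in> {1..n}" "real (i - 1) * h \<le> a" "a < b" "b \<le> real i * h" for i a b
  proof (cases "i \<le> k0")
    case True
    hence "real i * h \<le> real k0 * h" using h by simp
    thus ?thesis using that True
      by (simp add: \<mu>_def step_mean_def change_intensity_integral_before)
  next
    case False
    hence "k0 \<le> i - 1" by simp
    hence "real k0 * h \<le> real (i - 1) * h" using h by simp
    thus ?thesis using that False
      by (simp add: \<mu>_def step_mean_def change_intensity_integral_after)
  qed
  have cell_rate: "integral {real (i - 1) * h..real i * h} (change_intensity l1 l2 (real k0 * h))
      = \<mu> i * h" if "i \<in> {1..n}" for i
    using rate[OF that order_refl cell(2)[OF that] order_refl] cell(4)[OF that] by simp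
  have inc: "indep_vars (\<lambda>_. count_space UNIV)
      (\<lambda>j \<omega>. N (real (Suc j) * h) \<omega> - N (real j * h) \<omega>) {..<n}"
    using N h unfolding inhom_poisson_process_def
    by (elim conjE allE[of _ n] allE[of _ "\<lambda>j. real j * h"]) auto
  have "(\<lambda>i. i - 1) ` {1..n} \<subseteq> {..<n}" by auto
  hence "indep_vars (\<lambda>_. count_space UNIV)
      (\<lambda>i \<omega>. N (real (Suc (i - 1)) * h) \<omega> - N (real (i - 1) * h) \<omega>) {1..n}"
    by (intro indep_vars_reindex_inj[where f = "\<lambda>i. i - 1"] indep_vars_subset[OF inc])
      (auto simp: inj_on_def)
  hence "indep_vars (\<lambda>_. borel)
      (\<lambda>i \<omega>. (if 1 \<le> N (real (Suc (i - 1)) * h) \<omega> - N (real (i - 1) * h) \<omega> then 1 else 0) / h) {1..n}"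
    by (rule indep_vars_compose2[where Y = "\<lambda>_ j. (if 1 \<le> j then 1 else 0) / h"]) auto
  thus "indep_vars (\<lambda>_. borel) (jump_var h N) {1..n}"
    by (rule indep_vars_cong[THEN iffD1, rotated 3]) (auto simp: jump_var_def fun_eq_iff)
  show "expectation (jump_var h N i) = step_mean k0 (gamma_mean l1 h) (gamma_mean l2 h) i"
    if i: "i \<in> {1..n}" for i
  proof -
    have x: "0 \<le> \<mu> i * h" using \<mu> h by simp
    let ?J = "{\<omega>\<in>space M. 1 \<le> N (real i * h) \<omega> - N (real (i - 1) * h) \<omega>}"
    have J: "?J \<in> events" "prob ?J = 1 - exp (- (\<mu> i * h))"
      by (rule poisson_increment_events[OF N cell(1-3)[OF i] cell_rate[OF i] x]
          poisson_prob_ge_1[OF N cell(1-3)[OF i] cell_rate[OF i] x])+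
    have "expectation (jump_var h N i) = expectation (\<lambda>\<omega>. indicator ?J \<omega> / h)"
      by (intro Bochner_Integration.integral_cong) (auto simp: jump_var_def)
    also have "\<dots> = prob ?J / h" using J(1) by simp
    finally show ?thesis unfolding J(2) by (simp add: \<mu>_def step_mean_def gamma_mean_def)
  qed
  have "AE \<omega> in M. switch_var v h (\<lambda>i. telegraph V N (real i * h) \<omega>) i = jump_var h N i \<omega>"
    if i: "i \<in> {1..n}" for i
  proof -
    have "AE \<omega> in M. \<bar>telegraph V N (real i * h) \<omega> - telegraph V N (real (i - 1) * h) \<omega>\<bar>
        < v * (real i * h - real (i - 1) * h) \<longleftrightarrow>
        1 \<le> N (real i * h) \<omega> - N (real (i - 1) * h) \<omega>"
      by (rule increment_detects_events[OF X v cell(1-3)[OF i] \<mu> rate[OF i]])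
    thus ?thesis
      unfolding cell(4)[OF i] by (rule eventually_mono) (auto simp: switch_var_def jump_var_def)
  qed
  thus "AE \<omega> in M. \<forall>i\<in>{1..n}.
      switch_var v h (\<lambda>i. telegraph V N (real i * h) \<omega>) i = jump_var h N i \<omega>"
    by (intro AE_finite_allI) auto
qed

section \<open>The rate of convergence\<close>

theorem theorem3p2:
  fixes M :: "nat \<Rightarrow> 'a measure"
    and v l1 l2 \<tau> :: real
    and \<Delta> :: "nat \<Rightarrow> real"
    and V0 :: "nat \<Rightarrow> 'a \<Rightarrow> real"
    and N :: "nat \<Rightarrow> real \<Rightarrow> 'a \<Rightarrow> nat"
    and Y :: "nat \<Rightarrow> 'a \<Rightarrow> nat \<Rightarrow> real"
    and khat :: "nat \<Rightarrow> 'a \<Rightarrow> nat"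
  assumes v: "v > 0"
    and rates: "l1 > 0" "l2 > 0" "l1 \<noteq> l2"
    and tau: "0 < \<tau>" "\<tau> < 1"
    and mesh_pos: "\<And>n. n \<ge> 2 \<Longrightarrow> \<Delta> n > 0"
    and mesh_lim: "\<Delta> \<longlonglongrightarrow> 0"
    and horizon_lim: "filterlim (\<lambda>n. real n * \<Delta> n) at_top sequentially"
    and prob: "\<And>n. n \<ge> 2 \<Longrightarrow> prob_space (M n)"
    and process: "\<And>n. n \<ge> 2 \<Longrightarrow>
      prob_space.telegraph_data (M n) v (real n * \<Delta> n)
        (change_intensity l1 l2 (real (change_index n \<tau>) * \<Delta> n)) (V0 n) (N n)"
    and Y_def: "\<And>n \<omega>. n \<ge> 2 \<Longrightarrow> \<omega> \<in> space (M n) \<Longrightarrow>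
      Y n \<omega> = switch_var v (\<Delta> n) (\<lambda>i. telegraph (V0 n) (N n) (real i * \<Delta> n) \<omega>)"
    and khat_rv: "\<And>n. n \<ge> 2 \<Longrightarrow> khat n \<in> measurable (M n) (count_space UNIV)"
    and khat_lse: "\<And>n \<omega>. n \<ge> 2 \<Longrightarrow> \<omega> \<in> space (M n) \<Longrightarrow>
      is_lse_change_point n (Y n \<omega>) (khat n \<omega>)"
  shows "bigO_prob M (\<lambda>n \<omega>. real (khat n \<omega>) / real n - \<tau>)
     (\<lambda>n. 1 / (real n * \<Delta> n * (gamma_mean l2 (\<Delta> n) - gamma_mean l1 (\<Delta> n))\<^sup>2))"
proof -
  have mesh: "filterlim \<Delta> (at 0) sequentially"
  proof -
    have "eventually (\<lambda>n. \<Delta> n \<noteq> 0) sequentially"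
      using eventually_ge_at_top[of 2] by (rule eventually_mono) (use mesh_pos in force)
    thus ?thesis using mesh_lim by (simp add: filterlim_at)
  qed
  define G where "G = max l1 l2"
  define D where "D = \<bar>l2 - l1\<bar>"
  define c where "c = min \<tau> (1 - \<tau>) / 2"
  define r where "r = c * (D / 2) / 5"
  have pos: "0 < G" "0 < D" "0 < c" "0 < r"
    using rates tau by (auto simp: G_def D_def c_def r_def)
  have c: "2 * c \<le> \<tau>" "2 * c \<le> 1 - \<tau>" by (auto simp: c_def)
  define g1 g2 where "g1 = (\<lambda>n. gamma_mean l1 (\<Delta> n))" and "g2 = (\<lambda>n. gamma_mean l2 (\<Delta> n))"
  have "(\<lambda>n. \<bar>g2 n - g1 n\<bar>) \<longlonglongrightarrow> D"
    unfolding g1_def g2_def D_def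
    by (intro tendsto_rabs tendsto_diff filterlim_compose[OF gamma_mean_tendsto mesh])
  hence ev_gap: "eventually (\<lambda>n. D / 2 < \<bar>g2 n - g1 n\<bar>) sequentially"
    by (rule order_tendstoD) (use pos in simp)
  have ev_mesh: "eventually (\<lambda>n. \<Delta> n < 1) sequentially"
    using mesh_lim by (rule order_tendstoD) simp
  show ?thesis
    unfolding bigO_prob_def
  proof (intro allI impI)
    fix \<epsilon> :: real assume \<epsilon>: "0 < \<epsilon>"
    (* The window m is about K / h. With these constants each of the three error terms, which appear once
       for each side, is at most epsilon / 7. *)
    define K where "K = 42 * G / (r\<^sup>2 * \<epsilon>)"
    define A where "A = 7 * (K + 1) * G / \<epsilon>"
    define x where "x = \<epsilon> / (7 * G)"
    have K: "0 < K" "0 < A" "0 < x" using pos \<epsilon> by (auto simp: K_def A_def x_def add_pos_pos)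
    (* B bounds h times the left-hand side of the condition on n in the deviation bound; C comes from
       (m + 1) / n <= (K + 2) / (n h) and the fact that the two levels differ by at most G. *)
    define B where "B = A\<^sup>2 / x + (K + 1) * (G + r)\<^sup>2"
    define C where "C = G\<^sup>2 * (K + 2)"
    have "0 < C" using pos K by (simp add: C_def)
    moreover have "eventually (\<lambda>n. measure (M n) {\<omega>\<in>space (M n).
        \<bar>real (khat n \<omega>) / real n - \<tau>\<bar> >
        C * \<bar>1 / (real n * \<Delta> n * (gamma_mean l2 (\<Delta> n) - gamma_mean l1 (\<Delta> n))\<^sup>2)\<bar>} < \<epsilon>) sequentially"
      using ev_gap ev_mesh
        eventually_ge_at_top[of "max 2 (nat \<lceil>1 / c\<rceil>)"]
        filterlim_at_top_dense[THEN iffD1, OF horizon_lim, rule_format, of "B / (c\<^sup>2 * r\<^sup>2)"]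
        filterlim_at_top_dense[THEN iffD1, OF horizon_lim, rule_format, of "(K + 1) / c"]
    proof eventually_elim
      case (elim n)
      define h where "h = \<Delta> n"
      define k0 where "k0 = change_index n \<tau>"
      define m where "m = nat \<lceil>K / h\<rceil>"
      have n: "2 \<le> n" and h: "0 < h" "h < 1" using elim mesh_pos by (auto simp: h_def)
      have "1 / c \<le> real n" using elim(3) by linarith
      hence cn: "1 \<le> c * real n" using pos by (simp add: field_simps)
      interpret prob_space "M n" using prob[OF n] .
      have X: "telegraph_data v (real n * h) (change_intensity l1 l2 (real k0 * h)) (V0 n) (N n)"
        using process[OF n] by (simp add: h_def k0_def)
      have k0_floor: "real k0 \<le> real n * \<tau>" "real n * \<tau> - 1 < real k0"
        using tau by (simp_all add: k0_def change_index_def)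
      have "real n * (2 * c) \<le> real n * \<tau>" "real n * (2 * c) \<le> real n * (1 - \<tau>)"
        using c by (auto intro!: mult_left_mono)
      moreover have "real n * (2 * c) = 2 * (c * real n)" "real n * (1 - \<tau>) = real n - real n * \<tau>"
        by (simp_all add: algebra_simps)
      ultimately have k0: "c * real n \<le> real k0" "c * real n \<le> real n - real k0"
        using k0_floor cn by linarith+
      hence k0': "c * real n \<le> real (n - k0)" by linarith
      have m: "1 \<le> m" "K / h \<le> real m" "real m < K / h + 1"
      proof -
        have Kh: "0 < K / h" using K h by simp
        thus "1 \<le> m" unfolding m_def by linarith
        show "K / h \<le> real m" unfolding m_def by (rule real_nat_ceiling_ge)
        show "real m < K / h + 1" unfolding m_def using Kh by linarith
      qed
      have mh: "K \<le> real m * h" "real m * h \<le> K + 1"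
        using m h by (simp_all add: field_simps)
      have "real m * h \<le> c * real n * h"
        using mh(2) elim(5) pos by (simp add: h_def field_simps)
      hence "real m \<le> c * real n" using h by simp
      hence mk: "m \<le> k0" "m \<le> n - k0" using k0(1) k0' by linarith+
      have g: "0 \<le> g1 n" "g1 n \<le> G" "0 \<le> g2 n" "g2 n \<le> G"
        using gamma_mean_bounds[of h l1] gamma_mean_bounds[of h l2] h rates
        by (auto simp: g1_def g2_def G_def h_def)
      have gap: "5 * r \<le> c * \<bar>g2 n - g1 n\<bar>"
        using elim(1) pos by (simp add: r_def)
      have large: "A\<^sup>2 / (x * h) + real m * (G + r)\<^sup>2 < c\<^sup>2 * r\<^sup>2 * real n"
      proof -
        have "A\<^sup>2 / x + real m * h * (G + r)\<^sup>2 \<le> B"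
          unfolding B_def using mh(2) by (intro add_left_mono mult_right_mono) auto
        also have "B < c\<^sup>2 * r\<^sup>2 * (real n * h)"
          using elim(4) pos by (simp add: h_def field_simps)
        also have "A\<^sup>2 / x + real m * h * (G + r)\<^sup>2 = (A\<^sup>2 / (x * h) + real m * (G + r)\<^sup>2) * h"
          using h by (simp add: distrib_right)
        finally have "(A\<^sup>2 / (x * h) + real m * (G + r)\<^sup>2) * h < c\<^sup>2 * r\<^sup>2 * real n * h"
          by (simp add: mult.assoc)
        thus ?thesis using h by simp
      qed
      let ?J = "jump_var h (N n)"
      have "\<exists>E\<in>events. prob E \<le> 2 * (6 * G / (h * r\<^sup>2 * real m) + real m * h * G / A + x * G) \<and>
        (\<forall>\<omega>\<in>space (M n) - E. \<forall>k. is_lse_change_point n (\<lambda>i. ?J i \<omega>) k \<longrightarrow>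
          \<bar>real k - real k0\<bar> < real m)"
      proof (rule lse_deviation_prob)
        show "indep_vars (\<lambda>_. borel) ?J {1..n}"
          by (rule jump_var_indep[OF X v h(1)]) (use rates in auto)
        show "expectation (?J i) = step_mean k0 (g1 n) (g2 n) i" if "i \<in> {1..n}" for i
          using jump_var_mean[OF X v h(1) _ _ that] rates by (simp add: g1_def g2_def h_def)
        show "?J i \<omega> \<in> {0, 1 / h}" for i \<omega> by (simp add: jump_var_def)
      qed (use h pos gap k0 k0' m mk g K large in auto)
      then obtain E where E: "E \<in> events"
        "prob E \<le> 2 * (6 * G / (h * r\<^sup>2 * real m) + real m * h * G / A + x * G)"
        "\<And>\<omega> k. \<omega> \<in> space (M n) - E \<Longrightarrow> is_lse_change_point n (\<lambda>i. ?J i \<omega>) k \<Longrightarrow>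
          \<bar>real k - real k0\<bar> < real m"
        by blast
      have E_small: "prob E < \<epsilon>"
      proof -
        have "6 * G / (h * r\<^sup>2 * real m) = 6 * G / r\<^sup>2 / (real m * h)" by (simp add: mult_ac)
        also have "\<dots> \<le> 6 * G / r\<^sup>2 / K"
          using mh K pos h m by (intro divide_left_mono) auto
        also have "\<dots> = \<epsilon> / 7" using pos \<epsilon> by (simp add: K_def field_simps)
        finally have 1: "6 * G / (h * r\<^sup>2 * real m) \<le> \<epsilon> / 7" .
        have "real m * h * G / A \<le> (K + 1) * G / A"
          using mh K pos by (intro divide_right_mono mult_right_mono) auto
        also have "\<dots> = \<epsilon> / 7"
        proof -
          have "(K + 1) * G \<noteq> 0" using pos K by simp
          moreover have "A = (K + 1) * G * (7 / \<epsilon>)" by (simp add: A_def)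
          ultimately show ?thesis by simp
        qed
        finally have 2: "real m * h * G / A \<le> \<epsilon> / 7" .
        have 3: "x * G = \<epsilon> / 7" using pos by (simp add: x_def)
        show ?thesis using E(2) 1 2 3 \<epsilon> by argo
      qed
      have close: "\<bar>real k / real n - \<tau>\<bar> \<le>
          C * \<bar>1 / (real n * h * (g2 n - g1 n)\<^sup>2)\<bar>" if "\<bar>real k - real k0\<bar> < real m" for k
      proof -
        have n0: "0 < real n" using n by simp
        have "\<bar>real k - real n * \<tau>\<bar> \<le> real m + 1" using that k0_floor by linarith
        also have "\<dots> \<le> K / h + 2 / h"
        proof -
          have "2 \<le> 2 / h" using h by (simp add: field_simps)
          thus ?thesis using m(3) by linarith
        qed
        also have "\<dots> = (K + 2) / h" by (simp add: add_divide_distrib)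
        finally have "\<bar>real k - real n * \<tau>\<bar> / real n \<le> (K + 2) / h / real n"
          using n0 by (intro divide_right_mono) auto
        moreover have "real k / real n - \<tau> = (real k - real n * \<tau>) / real n"
          using n0 by (simp add: field_simps)
        ultimately have "\<bar>real k / real n - \<tau>\<bar> \<le> (K + 2) / (real n * h)"
          using n0 by (simp add: mult.commute)
        also have "\<dots> = C * (1 / (real n * h * G\<^sup>2))"
          using pos by (simp add: C_def)
        also have "\<dots> \<le> C * (1 / (real n * h * (g2 n - g1 n)\<^sup>2))"
        proof -
          have "\<bar>g2 n - g1 n\<bar> \<le> \<bar>G\<bar>" using g by linarith
          hence "(g2 n - g1 n)\<^sup>2 \<le> G\<^sup>2" by (simp only: abs_le_square_iff)
          moreover have "0 < (g2 n - g1 n)\<^sup>2" using elim(1) pos by auto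
          ultimately show ?thesis using n0 h pos \<open>0 < C\<close>
            by (intro mult_left_mono divide_left_mono mult_pos_pos) auto
        qed
        also have "\<dots> = C * \<bar>1 / (real n * h * (g2 n - g1 n)\<^sup>2)\<bar>" using h by simp
        finally show ?thesis .
      qed
      have "AE \<omega> in M n. \<forall>i\<in>{1..n}.
          switch_var v h (\<lambda>i. telegraph (V0 n) (N n) (real i * h) \<omega>) i = ?J i \<omega>"
        by (rule AE_switch_var_eq_jump_var[OF X v h(1)]) (use rates in auto)
      moreover have "AE \<omega> in M n. \<omega> \<in> space (M n)" by (rule AE_space)
      ultimately have "AE \<omega> in M n. \<omega> \<notin> E \<longrightarrow>
          \<bar>real (khat n \<omega>) / real n - \<tau>\<bar> \<le> C * \<bar>1 / (real n * h * (g2 n - g1 n)\<^sup>2)\<bar>"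
      proof eventually_elim
        case (elim \<omega>)
        have "split_sse n (Y n \<omega>) k = split_sse n (\<lambda>i. ?J i \<omega>) k" if "k \<le> n" for k
          by (rule split_sse_cong) (use elim that Y_def[OF n] in \<open>auto simp: h_def\<close>)
        hence "is_lse_change_point n (\<lambda>i. ?J i \<omega>) (khat n \<omega>)"
          using khat_lse[OF n elim(2)] n
          by (auto simp: is_lse_change_point_def is_arg_min_def)
        thus ?case using E(3) elim(2) close by blast
      qed
      hence "measure (M n) {\<omega>\<in>space (M n). \<bar>real (khat n \<omega>) / real n - \<tau>\<bar> >
          C * \<bar>1 / (real n * h * (g2 n - g1 n)\<^sup>2)\<bar>} \<le> prob E"
        by (intro finite_measure_mono_AE E) (auto elim!: eventually_mono)
      thus ?case using E_small by (simp add: h_def g1_def g2_def)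
    qed
    ultimately show "\<exists>C>0. eventually (\<lambda>n. measure (M n) {\<omega>\<in>space (M n).
        \<bar>real (khat n \<omega>) / real n - \<tau>\<bar> >
        C * \<bar>1 / (real n * \<Delta> n * (gamma_mean l2 (\<Delta> n) - gamma_mean l1 (\<Delta> n))\<^sup>2)\<bar>} < \<epsilon>) sequentially"
      by blast
  qed
qed

end
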